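(* Let $\mathcal{M}$ be a closed, connected, orientable, $n$-dimensional smooth manifold, let $h$ be a fixed smooth Riemannian metric on $\mathcal{M}$, and let $\alpha>0$. Let $x:\mathcal{M}\times[0,T)\to\mathbb{R}^{n+1}$ be a time-dependent embedding with $$\frac{\partial}{\partial t}x=-(H\nu)\circ x,\qquad x(\cdot,0)=x_0\ \text{on }\mathcal{M},$$ and let $\psi_\alpha:\mathcal{M}\times[0,T)\to\mathcal{M}$ be a family of diffeomorphisms $\psi_\alpha(t)$ with $$\frac{\partial}{\partial t}\psi_\alpha=\frac1\alpha\Delta_{h,g(t)}\psi_\alpha,\qquad g(t):=x(t)^*\mathfrak{e},\qquad \psi_\alpha(\cdot,0)=\mathrm{id}(\cdot)\ \text{on }\mathcal{M}.$$ Then the reparametrized mean curvature flow $\hat x_\alpha:\mathcal{M}\times[0,T)\to\mathbb{R}^{n+1}$ defined by $\hat x_\alpha(t):=x(t)\circ\psi_\alpha(t)$ satisfies $$\big(\alpha\hat\rho\,\mathbb{1}+(1-\alpha\hat\rho)(\nu\circ\hat x_\alpha)\otimes(\nu\circ\hat x_\alpha)\big)\frac{\partial}{\partial t}\hat x_\alpha=\Delta_{\hat g_\alpha(t)}\hat x_\alpha+\hat\rho\,(P\circ\hat x_\alpha)\,\Delta_h\hat x_\alpha,\qquad \hat x_\alpha(\cdot,0)=x_0(\cdot)\ \text{on }\mathcal{M},$$ where $\hat g_\alpha(t):=\hat x_\alpha(t)^*\mathfrak{e}$, $\hat\rho:=\sqrt{\det(h_{ij})}/\sqrt{\det(\hat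 g_{\alpha ij})}$ and $P:=\mathbb{1}-\nu\otimes\nu$.
   Context: Repeated indices are summed. $\mathfrak{e}$ is the Euclidean metric of $\mathbb{R}^{n+1}$; for an embedding $x$ with local representation $X=x\circ\mathcal{C}^{-1}$ in a chart $\mathcal{C}$, $x^*\mathfrak{e}$ has components $\frac{\partial X}{\partial\theta^i}\cdot\frac{\partial X}{\partial\theta^j}$. For a metric $g$, $(g^{ij})=(g_{ij})^{-1}$ and $\Gamma(g)^k_{ij}=\frac12g^{kl}(\partial_ig_{lj}+\partial_jg_{li}-\partial_lg_{ij})$. The Laplacian with respect to $g$ of $f$ with $F=f\circ\mathcal{C}^{-1}$ is $\Delta_gf=g^{ij}(\frac{\partial^2F}{\partial\theta^i\partial\theta^j}-\Gamma(g)^k_{ij}\frac{\partial F}{\partial\theta^k})$, applied componentwise to $\mathbb{R}^{n+1}$-valued maps. All maps are sufficiently regular: $x$ and $\psi_\alpha$ are at least of class $C^2$ in space and $C^1$ in time. $\nu$ is a unit normal field on $\Gamma(t):=x(\mathcal{M},t)=\hat x_\alpha(\mathcal{M},t)$, and the mean curvature $H$ is the sum of the principal curvatures, $H\circ X=-g^{ij}\frac{\partial^2X}{\partial\theta^i\partial\theta^j}\cdot(\nu\circ X)$ with $g=x^*\mathfrak{e}$; $H\nu$ is independent of the choice of $\nu$. $\mathbb{1}$ is the identity matrix of $\mathbb{R}^{n+1}$ and $(a\otimes b)c=a(b\cdot c)$. The function $\hat\rho$ is evaluated in any local coordinates of $\mathcal{M}$ and does not depend on their choice. Map Laplacian: for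 metrics $g_1,g_2$ on $\mathcal{M}$ and $\psi:\mathcal{M}\to\mathcal{M}$ with local representation $\Psi=\mathcal{C}_2\circ\psi\circ\mathcal{C}_1^{-1}$, $\Delta_{g_1,g_2}\psi$ is the vector field along $\psi$ with $\mathcal{C}_2$-components $g_1^{ij}\big(\frac{\partial^2\Psi^q}{\partial\theta^i\partial\theta^j}-\Gamma(g_1)^k_{ij}\frac{\partial\Psi^q}{\partial\theta^k}+(\Gamma(g_2)^q_{mn}\circ\Psi)\frac{\partial\Psi^m}{\partial\theta^i}\frac{\partial\Psi^n}{\partial\theta^j}\big)$, with $g_1$-quantities in the chart $\mathcal{C}_1$ and $g_2$-quantities in $\mathcal{C}_2$. *)

theory Defs
  imports "HOL-Analysis.Analysis"
begin

section \<open>Calculus on open subsets of Euclidean space\<close>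

text \<open>The \<open>i\<close>-th partial derivative. All functions it is applied to below are differentiable
  at the points in question, where this is the usual partial derivative.\<close>

definition pd :: "'n::finite \<Rightarrow> (real^'n \<Rightarrow> 'b::real_normed_vector) \<Rightarrow> real^'n \<Rightarrow> 'b" where
  "pd i f u = frechet_derivative f (at u) (axis i 1)"

text \<open>Class \<open>C\<^sup>k\<close>; only meant for open \<open>S\<close>, since the derivatives are taken in the full space.\<close>

primrec Ck_on :: "nat \<Rightarrow> (real^'n::finite) set \<Rightarrow> (real^'n \<Rightarrow> 'b::real_normed_vector) \<Rightarrow> bool" where
  "Ck_on 0 S f \<longleftrightarrow> continuous_on S f"
| "Ck_on (Suc k) S f \<longleftrightarrow> (\<forall>u\<in>S. f differentiable (at u)) \<and> (\<forall>i. Ck_on k S (pd i f))"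

definition smooth_on :: "(real^'n::finite) set \<Rightarrow> (real^'n \<Rightarrow> 'b::real_normed_vector) \<Rightarrow> bool" where
  "smooth_on S f \<longleftrightarrow> (\<forall>k. Ck_on k S f)"

text \<open>Class \<open>C\<^sup>2\<close> in space and \<open>C\<^sup>1\<close> in time: the space derivatives up to order two and the first
  time derivative exist and are jointly continuous in \<open>(t, u)\<close>. Here \<open>W\<close> is a relatively open
  subset of \<open>I \<times> \<real>\<^sup>n\<close>; time derivatives are one-sided at end points of the interval \<open>I\<close>.\<close>

definition C21_on ::
    "real set \<Rightarrow> (real \<times> (real^'n::finite)) set \<Rightarrow> (real \<Rightarrow> real^'n \<Rightarrow> 'b::real_normed_vector) \<Rightarrow> bool" where
  "C21_on I W F \<longleftrightarrow>
     (\<forall>t\<in>I. Ck_on 2 {u. (t, u) \<in> W} (F t)) \<and>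
     (\<forall>(t, u)\<in>W. (\<lambda>s. F s u) differentiable (at t within I)) \<and>
     continuous_on W (\<lambda>(t, u). F t u) \<and>
     (\<forall>i. continuous_on W (\<lambda>(t, u). pd i (F t) u)) \<and>
     (\<forall>i j. continuous_on W (\<lambda>(t, u). pd i (pd j (F t)) u)) \<and>
     continuous_on W (\<lambda>(t, u). vector_derivative (\<lambda>s. F s u) (at t within I))"


section \<open>Manifolds, given as a topological type with a smooth atlas\<close>

text \<open>A chart is a pair of an open domain and a coordinate map, whose values outside the domain
  are irrelevant.\<close>

type_synonym ('m, 'n) chart = "'m set \<times> ('m \<Rightarrow> real^'n)"

definition cdom :: "('m, 'n::finite) chart \<Rightarrow> 'm set" where
  "cdom C = fst C"

definition cmap :: "('m, 'n::finite) chart \<Rightarrow> 'm \<Rightarrow> real^'n" where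
  "cmap C = snd C"

definition cimg :: "('m, 'n::finite) chart \<Rightarrow> (real^'n) set" where
  "cimg C = cmap C ` cdom C"

definition cinv :: "('m, 'n::finite) chart \<Rightarrow> real^'n \<Rightarrow> 'm" where
  "cinv C = inv_into (cdom C) (cmap C)"

definition is_chart :: "('m::topological_space, 'n::finite) chart \<Rightarrow> bool" where
  "is_chart C \<longleftrightarrow> open (cdom C) \<and> open (cimg C) \<and>
     homeomorphism (cdom C) (cimg C) (cmap C) (cinv C)"

definition overlap :: "('m, 'n::finite) chart \<Rightarrow> ('m, 'n) chart \<Rightarrow> (real^'n) set" where
  "overlap C1 C2 = cmap C1 ` (cdom C1 \<inter> cdom C2)"

definition transition :: "('m, 'n::finite) chart \<Rightarrow> ('m, 'n) chart \<Rightarrow> real^'n \<Rightarrow> real^'n" where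
  "transition C1 C2 = cmap C2 \<circ> cinv C1"

text \<open>The atlas is not required to be maximal; the maximal one is among those allowed.\<close>

definition smooth_atlas :: "('m::topological_space, 'n::finite) chart set \<Rightarrow> bool" where
  "smooth_atlas A \<longleftrightarrow> (\<forall>C\<in>A. is_chart C) \<and> (\<Union>C\<in>A. cdom C) = UNIV \<and>
     (\<forall>C1\<in>A. \<forall>C2\<in>A. smooth_on (overlap C1 C2) (transition C1 C2))"

definition orientable :: "('m::topological_space, 'n::finite) chart set \<Rightarrow> bool" where
  "orientable A \<longleftrightarrow> (\<exists>B. smooth_atlas B \<and> smooth_atlas (A \<union> B) \<and>
     (\<forall>C1\<in>B. \<forall>C2\<in>B. \<forall>u\<in>overlap C1 C2. det (jacobian (transition C1 C2) (at u)) > 0))"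

text \<open>Hausdorff and second countable are part of the sort of the type of points.\<close>

definition closed_connected_orientable_manifold ::
    "('m::{t2_space, second_countable_topology}, 'n::finite) chart set \<Rightarrow> bool" where
  "closed_connected_orientable_manifold A \<longleftrightarrow>
     compact (UNIV :: 'm set) \<and> connected (UNIV :: 'm set) \<and> smooth_atlas A \<and> orientable A"

definition Ck_map ::
    "nat \<Rightarrow> ('m::topological_space, 'n::finite) chart set \<Rightarrow> ('m \<Rightarrow> 'm) \<Rightarrow> bool" where
  "Ck_map k A f \<longleftrightarrow> continuous_on UNIV f \<and>
     (\<forall>C1\<in>A. \<forall>C2\<in>A. Ck_on k {u \<in> cimg C1. f (cinv C1 u) \<in> cdom C2} (cmap C2 \<circ> f \<circ> cinv C1))"

definition Ck_diffeo ::
    "nat \<Rightarrow> ('m::topological_space, 'n::finite) chart set \<Rightarrow> ('m \<Rightarrow> 'm) \<Rightarrow> bool" where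
  "Ck_diffeo k A f \<longleftrightarrow> bij f \<and> Ck_map k A f \<and> Ck_map k A (inv f)"

definition embedding ::
    "('m::topological_space, 'n::finite) chart set \<Rightarrow> ('m \<Rightarrow> real^'k::finite) \<Rightarrow> bool" where
  "embedding A f \<longleftrightarrow> (\<exists>f'. homeomorphism UNIV (range f) f f') \<and>
     (\<forall>C\<in>A. \<forall>u\<in>cimg C. (f \<circ> cinv C) differentiable (at u) \<and>
        inj (frechet_derivative (f \<circ> cinv C) (at u)))"

definition C21_family_into_space ::
    "('m::topological_space, 'n::finite) chart set \<Rightarrow> real set \<Rightarrow> (real \<Rightarrow> 'm \<Rightarrow> real^'k::finite) \<Rightarrow> bool" where
  "C21_family_into_space A I f \<longleftrightarrow>
     (\<forall>C\<in>A. C21_on I (I \<times> cimg C) (\<lambda>t. f t \<circ> cinv C))"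

definition C21_family_of_self_maps ::
    "('m::topological_space, 'n::finite) chart set \<Rightarrow> real set \<Rightarrow> (real \<Rightarrow> 'm \<Rightarrow> 'm) \<Rightarrow> bool" where
  "C21_family_of_self_maps A I f \<longleftrightarrow> continuous_on (I \<times> UNIV) (\<lambda>(t, p). f t p) \<and>
     (\<forall>C1\<in>A. \<forall>C2\<in>A. C21_on I {(t, u). t \<in> I \<and> u \<in> cimg C1 \<and> f t (cinv C1 u) \<in> cdom C2}
        (\<lambda>t. cmap C2 \<circ> f t \<circ> cinv C1))"


section \<open>Metrics and Laplacians\<close>

text \<open>A metric is the family of its component matrices: \<open>g C u $ i $ j\<close> is \<open>g\<^sub>i\<^sub>j\<close> in the chart
  \<open>C\<close> at the coordinate point \<open>u\<close>.\<close>

type_synonym ('m, 'n) metric = "('m, 'n) chart \<Rightarrow> real^'n \<Rightarrow> real^'n^'n"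

definition smooth_riemannian_metric ::
    "('m::topological_space, 'n::finite) chart set \<Rightarrow> ('m, 'n) metric \<Rightarrow> bool" where
  "smooth_riemannian_metric A g \<longleftrightarrow>
     (\<forall>C\<in>A. (\<forall>i j. smooth_on (cimg C) (\<lambda>u. g C u $ i $ j)) \<and>
        (\<forall>u\<in>cimg C. transpose (g C u) = g C u \<and> (\<forall>v. v \<noteq> 0 \<longrightarrow> v \<bullet> (g C u *v v) > 0))) \<and>
     (\<forall>C1\<in>A. \<forall>C2\<in>A. \<forall>u\<in>overlap C1 C2.
        g C1 u = transpose (jacobian (transition C1 C2) (at u)) ** g C2 (transition C1 C2 u)
                   ** jacobian (transition C1 C2) (at u))"

definition pullback_metric ::
    "('m \<Rightarrow> real^'k::finite) \<Rightarrow> ('m, 'n::finite) metric" where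
  "pullback_metric f C u = (\<chi> i j. pd i (f \<circ> cinv C) u \<bullet> pd j (f \<circ> cinv C) u)"

definition christoffel ::
    "(real^'n::finite \<Rightarrow> real^'n^'n) \<Rightarrow> 'n \<Rightarrow> 'n \<Rightarrow> 'n \<Rightarrow> real^'n \<Rightarrow> real" where
  "christoffel g k i j u = (1/2) * (\<Sum>l\<in>UNIV. matrix_inv (g u) $ k $ l *
     (pd i (\<lambda>v. g v $ l $ j) u + pd j (\<lambda>v. g v $ l $ i) u - pd l (\<lambda>v. g v $ i $ j) u))"

definition laplacian ::
    "('m, 'n::finite) chart \<Rightarrow> ('m, 'n) metric \<Rightarrow> ('m \<Rightarrow> 'b::real_normed_vector) \<Rightarrow> 'm \<Rightarrow> 'b" where
  "laplacian C g f p = (let F = f \<circ> cinv C; u = cmap C p in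
     \<Sum>i\<in>UNIV. \<Sum>j\<in>UNIV. matrix_inv (g C u) $ i $ j *\<^sub>R
       (pd i (pd j F) u - (\<Sum>k\<in>UNIV. christoffel (g C) k i j u *\<^sub>R pd k F u)))"

text \<open>The components, in the chart \<open>C2\<close> around \<open>f p\<close>, of the map Laplacian of \<open>f\<close> at \<open>p\<close>.\<close>

definition map_laplacian ::
    "('m, 'n::finite) chart \<Rightarrow> ('m, 'n) chart \<Rightarrow> ('m, 'n) metric \<Rightarrow> ('m, 'n) metric \<Rightarrow>
     ('m \<Rightarrow> 'm) \<Rightarrow> 'm \<Rightarrow> real^'n" where
  "map_laplacian C1 C2 g1 g2 f p = (let F = cmap C2 \<circ> f \<circ> cinv C1; u = cmap C1 p in
     \<chi> q. \<Sum>i\<in>UNIV. \<Sum>j\<in>UNIV. matrix_inv (g1 C1 u) $ i $ j *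
       (pd i (pd j (\<lambda>v. F v $ q)) u
        - (\<Sum>k\<in>UNIV. christoffel (g1 C1) k i j u * pd k (\<lambda>v. F v $ q) u)
        + (\<Sum>m\<in>UNIV. \<Sum>n\<in>UNIV. christoffel (g2 C2) q m n (F u)
             * pd i (\<lambda>v. F v $ m) u * pd j (\<lambda>v. F v $ n) u)))"


section \<open>Hypersurfaces\<close>

definition unit_normal_field ::
    "('m, 'n::finite) chart set \<Rightarrow> ('m \<Rightarrow> real^'k::finite) \<Rightarrow> (real^'k \<Rightarrow> real^'k) \<Rightarrow> bool" where
  "unit_normal_field A f \<nu> \<longleftrightarrow> continuous_on (range f) \<nu> \<and> (\<forall>p. norm (\<nu> (f p)) = 1) \<and>
     (\<forall>C\<in>A. \<forall>u\<in>cimg C. \<forall>i. pd i (f \<circ> cinv C) u \<bullet> \<nu> (f (cinv C u)) = 0)"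

text \<open>The mean curvature (sum of the principal curvatures) of the image of \<open>f\<close> at \<open>f p\<close>.\<close>

definition mean_curvature ::
    "('m, 'n::finite) chart \<Rightarrow> ('m \<Rightarrow> real^'k::finite) \<Rightarrow> (real^'k \<Rightarrow> real^'k) \<Rightarrow> 'm \<Rightarrow> real" where
  "mean_curvature C f \<nu> p = (let X = f \<circ> cinv C; u = cmap C p in
     - (\<Sum>i\<in>UNIV. \<Sum>j\<in>UNIV. matrix_inv (pullback_metric f C u) $ i $ j *
          (pd i (pd j X) u \<bullet> \<nu> (X u))))"

definition outer :: "real^'k::finite \<Rightarrow> real^'k \<Rightarrow> real^'k^'k" where
  "outer a b = (\<chi> i j. a $ i * b $ j)"

definition volume_ratio ::
    "('m, 'n::finite) chart \<Rightarrow> ('m, 'n) metric \<Rightarrow> ('m, 'n) metric \<Rightarrow> 'm \<Rightarrow> real" where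
  "volume_ratio C h g p = sqrt (det (h C (cmap C p))) / sqrt (det (g C (cmap C p)))"

end

theory Submission
  imports Defs
begin

text \<open>
  At a point, write \<open>x\<circ>\<psi>\<close> in charts as \<open>X\<circ>\<Psi>\<close>. By the Gauss formula, the second derivatives of the
  hypersurface parametrisation \<open>X\<close> are \<open>\<partial>\<^sub>m\<partial>\<^sub>n X = \<Gamma>\<^sup>q\<^sub>m\<^sub>n \<partial>\<^sub>q X + (\<partial>\<^sub>m\<partial>\<^sub>n X \<bullet> \<nu>) \<nu>\<close>, with the Christoffel symbols
  of the induced metric. Hence \<open>\<Delta>\<^sub>g\<^sub>h\<^sub>a\<^sub>t xhat = - H \<nu>\<close>, where \<open>H\<close> is invariant under reparametrisation, and
  the tangential part of \<open>\<Delta>\<^sub>h xhat\<close> is the push-forward \<open>\<tau>\<close> of the map Laplacian of \<open>\<psi>\<close> under \<open>dX\<close>. The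
  chain rule gives \<open>\<partial>\<^sub>t xhat = - H \<nu> + \<tau> / \<alpha>\<close>, so both sides of the equation equal \<open>- H \<nu> + \<rho> \<tau>\<close>.
\<close>

section \<open>Partial derivatives\<close>

lemma pd_eq:
  assumes "(f has_derivative f') (at u)"
  shows "pd i f u = f' (axis i 1)"
  using frechet_derivative_at[OF assms] by (simp add: pd_def)

text \<open>A linear map is determined by its values on the \<open>axis\<close> vectors. In this
  form of the derivative, the chain rule turns into sums over partial derivatives.\<close>

lemma has_derivative_pd:
  fixes f :: "real^'n::finite \<Rightarrow> 'b::real_normed_vector"
  assumes "f differentiable (at u)"
  shows "(f has_derivative (\<lambda>v. \<Sum>i\<in>UNIV. v $ i *\<^sub>R pd i f u)) (at u)"
proof -
  let ?D = "frechet_derivative f (at u)"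
  have D: "(f has_derivative ?D) (at u)"
    using assms by (simp add: frechet_derivative_works)
  have lin: "linear ?D"
    using D has_derivative_linear by blast
  have "?D v = (\<Sum>i\<in>UNIV. v $ i *\<^sub>R pd i f u)" for v
  proof -
    have "?D v = ?D (\<Sum>i\<in>UNIV. v $ i *\<^sub>R axis i 1)"
      using basis_expansion[of v] by (simp add: scalar_mult_eq_scaleR)
    also have "\<dots> = (\<Sum>i\<in>UNIV. v $ i *\<^sub>R pd i f u)"
      by (simp add: linear_sum[OF lin] linear_cmul[OF lin] pd_def)
    finally show ?thesis .
  qed
  then have "?D = (\<lambda>v. \<Sum>i\<in>UNIV. v $ i *\<^sub>R pd i f u)" by blast
  then show ?thesis using D by simp
qed

text \<open>Holds without differentiability: \<open>f\<close> and \<open>g\<close> have the same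
  derivatives at \<open>u\<close>, and \<open>frechet_derivative\<close> is a choice among these.
  Needed because representations in charts agree only locally.\<close>

lemma pd_cong:
  assumes "open S" "u \<in> S" "\<And>v. v \<in> S \<Longrightarrow> f v = g v"
  shows "pd i f u = pd i g u"
proof -
  have "(f has_derivative D) (at u) \<longleftrightarrow> (g has_derivative D) (at u)" for D
    using has_derivative_transform_within_open[OF _ assms(1,2)] assms(3) by metis
  then show ?thesis by (simp add: pd_def frechet_derivative_def)
qed

lemma differentiable_cong_open:
  assumes "open S" "u \<in> S" "\<And>v. v \<in> S \<Longrightarrow> f v = g v"
  shows "f differentiable (at u) \<longleftrightarrow> g differentiable (at u)"
  using has_derivative_transform_within_open[OF _ assms(1,2)] assms(3)
  unfolding differentiable_def by metis

lemma Ck_on_cong: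
  assumes "open S" "\<And>v. v \<in> S \<Longrightarrow> f v = g v"
  shows "Ck_on k S f \<longleftrightarrow> Ck_on k S g"
  using assms(2)
proof (induction k arbitrary: f g)
  case 0
  then show ?case by (simp cong: continuous_on_cong)
next
  case (Suc k)
  have "Ck_on k S (pd i f) \<longleftrightarrow> Ck_on k S (pd i g)" for i
    using Suc.prems by (intro Suc.IH pd_cong[OF assms(1)])
  moreover have "f differentiable (at u) \<longleftrightarrow> g differentiable (at u)" if "u \<in> S" for u
    using Suc.prems by (intro differentiable_cong_open[OF assms(1) that])
  ultimately show ?case by simp
qed

lemma pd_vec_nth:
  assumes "f differentiable (at u)"
  shows "pd i (\<lambda>v. f v $ q) u = pd i f u $ q"
proof -
  obtain f' where f': "(f has_derivative f') (at u)"
    using assms by (auto simp: differentiable_def)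
  show ?thesis
    using pd_eq[OF f'] pd_eq[OF bounded_linear.has_derivative[OF bounded_linear_vec_nth f']] by simp
qed

lemma pd_inner:
  fixes f g :: "real^'n::finite \<Rightarrow> 'b::real_inner"
  assumes "f differentiable (at u)" "g differentiable (at u)"
  shows "pd i (\<lambda>v. f v \<bullet> g v) u = pd i f u \<bullet> g u + f u \<bullet> pd i g u"
proof -
  obtain f' g' where f': "(f has_derivative f') (at u)" and g': "(g has_derivative g') (at u)"
    using assms by (auto simp: differentiable_def)
  show ?thesis
    using pd_eq[OF f'] pd_eq[OF g'] pd_eq[OF has_derivative_inner[OF f' g']] by simp
qed

lemma pd_scaleR:
  fixes f :: "real^'n::finite \<Rightarrow> real" and g :: "real^'n \<Rightarrow> 'b::real_normed_vector"
  assumes "f differentiable (at u)" "g differentiable (at u)"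
  shows "pd i (\<lambda>v. f v *\<^sub>R g v) u = pd i f u *\<^sub>R g u + f u *\<^sub>R pd i g u"
proof -
  obtain f' g' where f': "(f has_derivative f') (at u)" and g': "(g has_derivative g') (at u)"
    using assms by (auto simp: differentiable_def)
  show ?thesis
    using pd_eq[OF f'] pd_eq[OF g'] pd_eq[OF has_derivative_scaleR[OF f' g']] by simp
qed

lemma pd_sum:
  fixes f :: "'a \<Rightarrow> real^'n::finite \<Rightarrow> 'b::real_normed_vector"
  assumes "\<And>a. a \<in> A \<Longrightarrow> f a differentiable (at u)"
  shows "pd i (\<lambda>v. \<Sum>a\<in>A. f a v) u = (\<Sum>a\<in>A. pd i (f a) u)"
proof -
  have "(f a has_derivative frechet_derivative (f a) (at u)) (at u)" if "a \<in> A" for a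
    using assms[OF that] by (simp add: frechet_derivative_works)
  then have "((\<lambda>v. \<Sum>a\<in>A. f a v) has_derivative (\<lambda>v. \<Sum>a\<in>A. frechet_derivative (f a) (at u) v)) (at u)"
    by (rule has_derivative_sum)
  from pd_eq[OF this] show ?thesis by (simp add: pd_def)
qed

section \<open>Chain rules of first and second order\<close>

lemma pd_comp:
  fixes X :: "real^'n::finite \<Rightarrow> 'b::real_normed_vector" and \<Psi> :: "real^'m::finite \<Rightarrow> real^'n"
  assumes \<Psi>: "\<Psi> differentiable (at u)" and X: "X differentiable (at (\<Psi> u))"
  shows "pd i (X \<circ> \<Psi>) u = (\<Sum>q\<in>UNIV. pd i \<Psi> u $ q *\<^sub>R pd q X (\<Psi> u))"
proof -
  obtain D where D: "(\<Psi> has_derivative D) (at u)"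
    using \<Psi> by (auto simp: differentiable_def)
  show ?thesis
    using pd_eq[OF diff_chain_at[OF D has_derivative_pd[OF X]], of i] pd_eq[OF D, of i] by simp
qed

lemma Ck_on_2D:
  assumes "Ck_on 2 S f"
  shows "u \<in> S \<Longrightarrow> f differentiable (at u)"
    and "u \<in> S \<Longrightarrow> pd i f differentiable (at u)"
    and "continuous_on S (pd i (pd j f))"
  using assms by (auto simp: numeral_2_eq_2)

lemma differentiable_vec_nth:
  fixes f :: "'a::real_normed_vector \<Rightarrow> real^'n::finite"
  assumes "f differentiable (at u)"
  shows "(\<lambda>v. f v $ q) differentiable (at u)"
  using assms bounded_linear.has_derivative[OF bounded_linear_vec_nth] unfolding differentiable_def by blast

text \<open>The first-order formula holds on all of \<open>U\<close>, so it may be differentiated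
  once more. The product rule yields one sum with second derivatives of \<Psi> and one with those of
  \<open>X\<close>.\<close>

lemma pd_comp_second:
  fixes X :: "real^'n::finite \<Rightarrow> 'b::real_normed_vector" and \<Psi> :: "real^'m::finite \<Rightarrow> real^'n"
  assumes U: "open U" "u \<in> U" and \<Psi>: "Ck_on 2 U \<Psi>"
    and X: "Ck_on 2 V X" and \<Psi>V: "\<And>v. v \<in> U \<Longrightarrow> \<Psi> v \<in> V"
  shows "pd i (X \<circ> \<Psi>) differentiable (at u)"
    and "pd i (pd j (X \<circ> \<Psi>)) u = (\<Sum>q\<in>UNIV. pd i (pd j \<Psi>) u $ q *\<^sub>R pd q X (\<Psi> u))
      + (\<Sum>m\<in>UNIV. \<Sum>n\<in>UNIV. (pd i \<Psi> u $ m * pd j \<Psi> u $ n) *\<^sub>R pd m (pd n X) (\<Psi> u))"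
proof -
  have first: "pd j (X \<circ> \<Psi>) v = (\<Sum>q\<in>UNIV. pd j \<Psi> v $ q *\<^sub>R (pd q X \<circ> \<Psi>) v)" if "v \<in> U" for v j
    using pd_comp[OF Ck_on_2D(1)[OF \<Psi> that] Ck_on_2D(1)[OF X \<Psi>V[OF that]]] by simp
  have d1: "(\<lambda>v. pd j \<Psi> v $ q) differentiable (at u)" for j q
    using Ck_on_2D(2)[OF \<Psi> U(2)] by (rule differentiable_vec_nth)
  have \<Psi>u: "\<Psi> differentiable (at u)" and Xu: "pd q X differentiable (at (\<Psi> u))" for q
    using Ck_on_2D(1)[OF \<Psi> U(2)] Ck_on_2D(2)[OF X \<Psi>V[OF U(2)]] by auto
  have d2: "(pd q X \<circ> \<Psi>) differentiable (at u)" for q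
    using \<Psi>u Xu by (rule differentiable_chain_at)
  have d3: "(\<lambda>v. pd j \<Psi> v $ q *\<^sub>R (pd q X \<circ> \<Psi>) v) differentiable (at u)" for j q
    using d1 d2 by (rule differentiable_scaleR)
  have d4: "(\<lambda>v. \<Sum>q\<in>UNIV. pd j \<Psi> v $ q *\<^sub>R (pd q X \<circ> \<Psi>) v) differentiable (at u)" for j
    using d3 by (intro differentiable_sum) auto
  show "pd i (X \<circ> \<Psi>) differentiable (at u)"
    using d4 first by (subst differentiable_cong_open[OF U]) auto
  have "pd i (pd j (X \<circ> \<Psi>)) u = pd i (\<lambda>v. \<Sum>q\<in>UNIV. pd j \<Psi> v $ q *\<^sub>R (pd q X \<circ> \<Psi>) v) u"
    using first by (intro pd_cong[OF U]) auto
  also have "\<dots> = (\<Sum>q\<in>UNIV. pd i (\<lambda>v. pd j \<Psi> v $ q) u *\<^sub>R (pd q X \<circ> \<Psi>) u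
      + pd j \<Psi> u $ q *\<^sub>R pd i (pd q X \<circ> \<Psi>) u)"
    by (subst pd_sum, rule d3) (simp only: pd_scaleR[OF d1 d2])
  also have "\<dots> = (\<Sum>q\<in>UNIV. pd i (pd j \<Psi>) u $ q *\<^sub>R pd q X (\<Psi> u))
      + (\<Sum>n\<in>UNIV. \<Sum>m\<in>UNIV. (pd i \<Psi> u $ m * pd j \<Psi> u $ n) *\<^sub>R pd m (pd n X) (\<Psi> u))"
    by (simp add: sum.distrib pd_vec_nth Ck_on_2D(2)[OF \<Psi> U(2)] pd_comp[OF \<Psi>u Xu]
        scaleR_sum_right mult.commute)
  also have "(\<Sum>n\<in>UNIV. \<Sum>m\<in>UNIV. (pd i \<Psi> u $ m * pd j \<Psi> u $ n) *\<^sub>R pd m (pd n X) (\<Psi> u))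
      = (\<Sum>m\<in>UNIV. \<Sum>n\<in>UNIV. (pd i \<Psi> u $ m * pd j \<Psi> u $ n) *\<^sub>R pd m (pd n X) (\<Psi> u))"
    by (rule sum.swap)
  finally show "pd i (pd j (X \<circ> \<Psi>)) u = (\<Sum>q\<in>UNIV. pd i (pd j \<Psi>) u $ q *\<^sub>R pd q X (\<Psi> u))
      + (\<Sum>m\<in>UNIV. \<Sum>n\<in>UNIV. (pd i \<Psi> u $ m * pd j \<Psi> u $ n) *\<^sub>R pd m (pd n X) (\<Psi> u))" .
qed

section \<open>Symmetry of mixed second derivatives\<close>

text \<open>The left-hand side is symmetric in \<open>i\<close> and \<open>j\<close>, so letting \<open>h\<close> tend to 0 gives the symmetry of
  second derivatives.\<close>

lemma second_difference_mvt:
  fixes f :: "real^'n::finite \<Rightarrow> real"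
  assumes e: "0 < e" and B: "ball a (2 * e) \<subseteq> S" and f: "Ck_on 2 S f" and h: "0 < h" "h < e"
  shows "\<exists>s\<in>{0..h}. \<exists>r\<in>{0..h}.
    f (a + h *\<^sub>R axis i 1 + h *\<^sub>R axis j 1) - f (a + h *\<^sub>R axis i 1) - f (a + h *\<^sub>R axis j 1) + f a
      = h * h * pd j (pd i f) (a + s *\<^sub>R axis i 1 + r *\<^sub>R axis j 1)"
proof -
  let ?p = "\<lambda>s r. a + s *\<^sub>R axis i 1 + r *\<^sub>R (axis j 1 :: real^'n)"
  \<comment> \<open>All these points stay in the ball, as |s| + |r| <= 2h < 2e; the triangle
    inequality covers \<open>i = j\<close> too.\<close>
  have inS: "?p s r \<in> S" if "s \<in> {0..h}" "r \<in> {0..h}" for s r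
  proof -
    have "norm (s *\<^sub>R axis i 1 + r *\<^sub>R (axis j 1 :: real^'n)) \<le> \<bar>s\<bar> + \<bar>r\<bar>"
      by (rule norm_triangle_le) simp
    also have "\<dots> < 2 * e" using that h by auto
    finally have "dist a (?p s r) < 2 * e" by (simp add: dist_norm norm_minus_commute algebra_simps)
    then show ?thesis using B by auto
  qed
  have ps: "((\<lambda>s. ?p s r) has_derivative (\<lambda>d. d *\<^sub>R axis i 1)) (at s within T)" for s r T
    by (auto intro!: derivative_eq_intros)
  have pr: "((\<lambda>r. ?p s r) has_derivative (\<lambda>d. d *\<^sub>R axis j 1)) (at r within T)" for s r T
    by (auto intro!: derivative_eq_intros)
  have lin: "(\<Sum>k\<in>UNIV. (d *\<^sub>R axis i 1 :: real^'n) $ k *\<^sub>R pd k g u) = d * pd i g u" 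
    for d i u and g :: "real^'n \<Rightarrow> real"
    by (simp add: axis_def if_distrib[of "\<lambda>x. _ * x * _"] cong: if_cong)
  have f1: "((\<lambda>s. f (?p s r)) has_derivative (\<lambda>d. d * pd i f (?p s r))) (at s within T)"
    if "s \<in> {0..h}" "r \<in> {0..h}" for s r T
    using has_derivative_compose[OF ps has_derivative_pd[OF Ck_on_2D(1)[OF f inS[OF that]]]]
    by (simp only: lin)
  have f2: "((\<lambda>r. pd i f (?p s r)) has_derivative (\<lambda>d. d * pd j (pd i f) (?p s r))) (at r within T)"
    if "s \<in> {0..h}" "r \<in> {0..h}" for s r T
    using has_derivative_compose[OF pr has_derivative_pd[OF Ck_on_2D(2)[OF f inS[OF that]]]]
    by (simp only: lin)
  \<comment> \<open>Mean value theorem in \<open>s\<close> for the increment of \<open>f\<close>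
    over \<open>r\<close> from 0 to \<open>h\<close>; a second use, in \<open>r\<close>, follows for
    \<open>pd i f\<close>.\<close>
  have "\<exists>s\<in>{0..h}. (f (?p h h) - f (?p h 0)) - (f (?p 0 h) - f (?p 0 0))
      = (\<lambda>d. d * pd i f (?p s h) - d * pd i f (?p s 0)) (h - 0)"
    using h by (intro mvt_very_simple has_derivative_diff f1) auto
  then obtain s where s: "s \<in> {0..h}" and 1: "(f (?p h h) - f (?p h 0)) - (f (?p 0 h) - f (?p 0 0))
      = h * (pd i f (?p s h) - pd i f (?p s 0))"
    by (auto simp: algebra_simps)
  have "\<exists>r\<in>{0..h}. pd i f (?p s h) - pd i f (?p s 0) = (\<lambda>d. d * pd j (pd i f) (?p s r)) (h - 0)"
    using h s by (intro mvt_very_simple f2) auto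
  then obtain r where r: "r \<in> {0..h}" and 2: "pd i f (?p s h) - pd i f (?p s 0) = h * pd j (pd i f) (?p s r)"
    by auto
  from 1 2 s r show ?thesis by (intro bexI[of _ s] bexI[of _ r]) (auto simp: algebra_simps)
qed

lemma pd_commute_real:
  fixes f :: "real^'n::finite \<Rightarrow> real"
  assumes S: "open S" "a \<in> S" and f: "Ck_on 2 S f"
  shows "pd i (pd j f) a = pd j (pd i f) a"
proof (rule ccontr)
  assume ne: "pd i (pd j f) a \<noteq> pd j (pd i f) a"
  \<comment> \<open>Half the gap: the two mixed derivatives share a value at points near
    \<open>a\<close>, and each of these values is less than \<open>d\<close> away from the
    corresponding one at \<open>a\<close>.\<close>
  define d where "d = \<bar>pd i (pd j f) a - pd j (pd i f) a\<bar> / 2"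
  have d: "d > 0" using ne by (simp add: d_def)
  have near: "\<exists>e>0. \<forall>v. dist v a < e \<longrightarrow> dist (pd i (pd j f) v) (pd i (pd j f) a) < d" for i j
  proof -
    have "isCont (pd i (pd j f)) a"
      using Ck_on_2D(3)[OF f] S by (simp add: continuous_on_eq_continuous_at)
    then show ?thesis using d by (auto simp: continuous_at_eps_delta)
  qed
  obtain e1 where e1: "e1 > 0" "\<And>v. dist v a < e1 \<Longrightarrow> dist (pd i (pd j f) v) (pd i (pd j f) a) < d"
    using near by blast
  obtain e2 where e2: "e2 > 0" "\<And>v. dist v a < e2 \<Longrightarrow> dist (pd j (pd i f) v) (pd j (pd i f) a) < d"
    using near by blast
  obtain e3 where e3: "e3 > 0" "ball a e3 \<subseteq> S" using S open_contains_ball by blast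
  \<comment> \<open>Halving makes \<open>2 * e\<close> at most each of the three radii; the points
    from \<open>second_difference_mvt\<close> are within \<open>2 * e\<close> of
    \<open>a\<close>.\<close>
  define e where "e = Min {e1, e2, e3} / 2"
  have e: "e > 0" "2 * e \<le> e1" "2 * e \<le> e2" "2 * e \<le> e3"
    using e1(1) e2(1) e3(1) by (auto simp: e_def)
  have B: "ball a (2 * e) \<subseteq> S" using e(4) e3(2) by auto
  define h where "h = e / 2"
  have h: "0 < h" "h < e" using e by (auto simp: h_def)
  have close: "dist (a + s *\<^sub>R axis i 1 + r *\<^sub>R axis j 1) a < 2 * e" if "s \<in> {0..h}" "r \<in> {0..h}"
    for s r i j
  proof -
    have "norm (s *\<^sub>R axis i 1 + r *\<^sub>R (axis j 1 :: real^'n)) \<le> \<bar>s\<bar> + \<bar>r\<bar>"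
      by (rule norm_triangle_le) simp
    also have "\<dots> < 2 * e" using that h by auto
    finally show ?thesis by (simp add: dist_norm algebra_simps)
  qed
  obtain s r where sr: "s \<in> {0..h}" "r \<in> {0..h}" and
    1: "f (a + h *\<^sub>R axis i 1 + h *\<^sub>R axis j 1) - f (a + h *\<^sub>R axis i 1) - f (a + h *\<^sub>R axis j 1) + f a
      = h * h * pd j (pd i f) (a + s *\<^sub>R axis i 1 + r *\<^sub>R axis j 1)"
    using second_difference_mvt[OF e(1) B f h] by blast
  \<comment> \<open>The same with \<open>i\<close> and \<open>j\<close> exchanged; the left-hand
    sides agree.\<close>
  obtain s' r' where sr': "s' \<in> {0..h}" "r' \<in> {0..h}" and
    2: "f (a + h *\<^sub>R axis j 1 + h *\<^sub>R axis i 1) - f (a + h *\<^sub>R axis j 1) - f (a + h *\<^sub>R axis i 1) + f a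
      = h * h * pd i (pd j f) (a + s' *\<^sub>R axis j 1 + r' *\<^sub>R axis i 1)"
    using second_difference_mvt[OF e(1) B f h] by blast
  let ?v = "a + s *\<^sub>R axis i 1 + r *\<^sub>R axis j 1" and ?w = "a + s' *\<^sub>R axis j 1 + r' *\<^sub>R axis i 1"
  have "a + h *\<^sub>R axis j 1 + h *\<^sub>R axis i 1 = a + h *\<^sub>R axis i 1 + h *\<^sub>R axis j 1"
    by simp
  from 2[unfolded this] 1 have "h * h * pd j (pd i f) ?v = h * h * pd i (pd j f) ?w"
    by linarith
  then have "pd j (pd i f) ?v = pd i (pd j f) ?w" using h by simp
  moreover have "dist (pd j (pd i f) ?v) (pd j (pd i f) a) < d"
    by (rule e2(2)[OF less_le_trans[OF close[OF sr] e(3)]])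
  moreover have "dist (pd i (pd j f) ?w) (pd i (pd j f) a) < d"
    by (rule e1(2)[OF less_le_trans[OF close[OF sr'] e(2)]])
  ultimately show False unfolding d_def dist_real_def by (smt (verit) field_sum_of_halves)
qed

text \<open>Testing against a fixed \<open>w\<close> reduces statements on vector-valued functions
  to real ones.\<close>

lemma Ck_on_2_inner_const:
  fixes f :: "real^'n::finite \<Rightarrow> 'b::real_inner"
  assumes S: "open S" and f: "Ck_on 2 S f"
  shows "Ck_on 2 S (\<lambda>u. f u \<bullet> w)"
    and "u \<in> S \<Longrightarrow> pd i (\<lambda>u. f u \<bullet> w) u = pd i f u \<bullet> w"
    and "u \<in> S \<Longrightarrow> pd i (pd j (\<lambda>u. f u \<bullet> w)) u = pd i (pd j f) u \<bullet> w"
proof -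
  have pdc: "pd i (\<lambda>_. w) u = 0" for i and u :: "real^'n"
    using pd_eq[OF has_derivative_const[of w "at u"]] by simp
  have diff: "(\<lambda>u. g u \<bullet> w) differentiable (at u)" if "g differentiable (at u)"
    for g :: "real^'n \<Rightarrow> 'b" and u
    using that has_derivative_inner_left unfolding differentiable_def by blast
  have p1: "pd i (\<lambda>u. f u \<bullet> w) u = pd i f u \<bullet> w" if "u \<in> S" for i u
    using Ck_on_2D(1)[OF f that] by (simp add: pd_inner pdc)
  have p2: "pd i (pd j (\<lambda>u. f u \<bullet> w)) u = pd i (pd j f) u \<bullet> w" if "u \<in> S" for i j u
  proof -
    have "pd i (pd j (\<lambda>u. f u \<bullet> w)) u = pd i (\<lambda>u. pd j f u \<bullet> w) u"
      using p1 by (intro pd_cong[OF S that]) auto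
    then show ?thesis using Ck_on_2D(2)[OF f that] by (simp add: pd_inner pdc)
  qed
  show "u \<in> S \<Longrightarrow> pd i (\<lambda>u. f u \<bullet> w) u = pd i f u \<bullet> w"
    "u \<in> S \<Longrightarrow> pd i (pd j (\<lambda>u. f u \<bullet> w)) u = pd i (pd j f) u \<bullet> w"
    using p1 p2 by auto
  have "pd j (\<lambda>u. f u \<bullet> w) differentiable (at u)" if "u \<in> S" for j u
    using diff[OF Ck_on_2D(2)[OF f that]] p1 by (subst differentiable_cong_open[OF S that]) auto
  moreover have "continuous_on S (pd i (pd j (\<lambda>u. f u \<bullet> w)))" for i j
    using continuous_on_inner[OF Ck_on_2D(3)[OF f] continuous_on_const[of S w]] p2
    by (auto cong: continuous_on_cong)
  ultimately show "Ck_on 2 S (\<lambda>u. f u \<bullet> w)"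
    using diff Ck_on_2D(1)[OF f] by (auto simp: numeral_2_eq_2)
qed

text \<open>The mean value theorem as an equality is a result on real functions, so the symmetry is
  taken over from \<open>f u \<bullet> w\<close> for every \<open>w\<close>.\<close>

lemma pd_commute:
  fixes f :: "real^'n::finite \<Rightarrow> 'b::real_inner"
  assumes S: "open S" "a \<in> S" and f: "Ck_on 2 S f"
  shows "pd i (pd j f) a = pd j (pd i f) a"
proof -
  have "pd i (pd j f) a \<bullet> w = pd j (pd i f) a \<bullet> w" for w
    using pd_commute_real[OF S Ck_on_2_inner_const(1)[OF S(1) f]] Ck_on_2_inner_const(3)[OF S(1) f S(2)]
    by metis
  then show ?thesis by (metis vector_eq_ldot inner_commute)
qed

section \<open>Hypersurfaces in coordinates\<close>

text \<open>By injectivity the range of \<open>D\<close> has dimension \<open>CARD('n)\<close>.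
  Together with \<open>N\<close>, which lies outside it, it spans the whole space, so
  \<open>W\<close> is orthogonal to itself.\<close>

lemma orthogonal_to_hyperplane_and_normal_imp_zero:
  fixes D :: "real^'n::finite \<Rightarrow> real^'k::finite"
  assumes codim: "CARD('k) = CARD('n) + 1" and D: "linear D" "inj D"
    and N: "norm N = 1" "\<And>i. D (axis i 1) \<bullet> N = 0"
    and W: "W \<bullet> N = 0" "\<And>i. D (axis i 1) \<bullet> W = 0"
  shows "W = 0"
proof -
  have perp: "D v \<bullet> w = 0" if "\<And>i. D (axis i 1) \<bullet> w = 0" for v w
  proof -
    have "D v = D (\<Sum>i\<in>UNIV. v $ i *\<^sub>R axis i 1)"
      using basis_expansion[of v] by (simp add: scalar_mult_eq_scaleR)
    then show ?thesis
      using that by (simp add: linear_sum[OF D(1)] linear_cmul[OF D(1)] inner_sum_left)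
  qed
  have sp: "span (range D) = range D"
    using linear_subspace_image[OF D(1) subspace_UNIV] by (rule span_eq_iff[THEN iffD2])
  have "N \<notin> range D"
  proof
    assume "N \<in> range D"
    then have "N \<bullet> N = 0" using perp[OF N(2)] by fast
    then show False using N(1) by simp
  qed
  then have "dim (insert N (range D)) = dim (range D) + 1"
    by (simp add: dim_insert sp)
  also have "dim (range D) = CARD('n)"
    using dim_image_eq[OF D(1), of UNIV] D(2) by (simp add: dim_UNIV)
  finally have "span (insert N (range D)) = UNIV"
    using codim by (simp add: dim_eq_full[symmetric])
  then have "W \<in> span (insert N (range D))" by simp
  then have "orthogonal W W"
    using W perp[OF W(2)]
    by (elim orthogonal_to_span) (auto simp: orthogonal_def inner_commute)
  then show ?thesis by (simp add: orthogonal_def)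
qed

section \<open>Induced metric, Christoffel symbols and the Gauss formula\<close>

lemma frechet_derivative_eq_sum_pd:
  assumes "f differentiable (at u)"
  shows "frechet_derivative f (at u) v = (\<Sum>i\<in>UNIV. v $ i *\<^sub>R pd i f u)"
  using frechet_derivative_at[OF has_derivative_pd[OF assms]] by (metis (no_types, lifting))

text \<open>The components of the pullback of the Euclidean metric, free of charts so that they
  apply to \<open>X\<close> and to \<open>X \<circ> \<Psi>\<close> alike.\<close>

definition gram :: "(real^'n::finite \<Rightarrow> real^'k::finite) \<Rightarrow> real^'n \<Rightarrow> real^'n^'n" where
  "gram X u = (\<chi> i j. pd i X u \<bullet> pd j X u)"

lemma matrix_inv_mult:
  fixes A :: "real^'n^'n"
  assumes "invertible A"
  shows "A ** matrix_inv A = mat 1" "matrix_inv A ** A = mat 1"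
  using someI_ex[OF assms[unfolded invertible_def]] by (simp_all add: matrix_inv_def)

text \<open>The quadratic form of the Gram matrix at \<open>v\<close> is the squared length of the
  derivative applied to \<open>v\<close>, so a kernel vector has zero image and vanishes by
  injectivity.\<close>

lemma invertible_gram:
  fixes X :: "real^'n::finite \<Rightarrow> real^'k::finite"
  assumes X: "X differentiable (at u)" and inj: "inj (frechet_derivative X (at u))"
  shows "invertible (gram X u)"
proof -
  have "v = 0" if v: "gram X u *v v = 0" for v
  proof -
    let ?w = "\<Sum>i\<in>UNIV. v $ i *\<^sub>R pd i X u"
    have "?w \<bullet> ?w = (\<Sum>i\<in>UNIV. v $ i * (gram X u *v v) $ i)"
      by (simp add: inner_sum_left inner_sum_right gram_def matrix_vector_mult_def mult.commute
          inner_commute[of "pd _ X u" "pd _ X u"])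
    then have "?w = 0" using v by simp
    then have "frechet_derivative X (at u) v = frechet_derivative X (at u) 0"
      by (simp add: frechet_derivative_eq_sum_pd[OF X])
    then show ?thesis using inj by (auto dest: injD)
  qed
  then show ?thesis
    using matrix_left_invertible_ker[of "gram X u"] by (auto simp: invertible_left_inverse)
qed

lemma matrix_mult_nth:
  fixes A B :: "real^'n::finite^'n"
  shows "(A ** B) $ i $ j = (\<Sum>l\<in>UNIV. A $ i $ l * B $ l $ j)"
  by (simp add: matrix_matrix_mult_def)

text \<open>The product rule gives six terms; by symmetry of second derivatives four cancel in pairs
  and the other two coincide.\<close>

lemma christoffel_gram:
  fixes X :: "real^'n::finite \<Rightarrow> real^'k::finite"
  assumes S: "open S" "u \<in> S" and X: "Ck_on 2 S X"
  shows "christoffel (gram X) q m n u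
    = (\<Sum>l\<in>UNIV. matrix_inv (gram X u) $ q $ l * (pd m (pd n X) u \<bullet> pd l X u))"
proof -
  have pdg: "pd m (\<lambda>v. gram X v $ l $ n) u = pd m (pd l X) u \<bullet> pd n X u + pd l X u \<bullet> pd m (pd n X) u"
    for l m n
    using Ck_on_2D(2)[OF X S(2)] by (simp add: gram_def pd_inner)
  have "pd m (\<lambda>v. gram X v $ l $ n) u + pd n (\<lambda>v. gram X v $ l $ m) u - pd l (\<lambda>v. gram X v $ m $ n) u
    = 2 * (pd m (pd n X) u \<bullet> pd l X u)" for l
    unfolding pdg pd_commute[OF S X, of l m] pd_commute[OF S X, of l n] pd_commute[OF S X, of n m]
    by (simp add: inner_commute)
  then show ?thesis
    by (simp add: christoffel_def sum_distrib_left)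
qed

text \<open>The Gauss formula: the difference of the two sides is orthogonal to the tangent space and
  to the normal.\<close>

lemma gauss_formula:
  fixes X :: "real^'n::finite \<Rightarrow> real^'k::finite"
  assumes codim: "CARD('k) = CARD('n) + 1"
    and S: "open S" "u \<in> S" and X: "Ck_on 2 S X"
    and inj: "inj (frechet_derivative X (at u))"
    and N: "norm N = 1" "\<And>i. pd i X u \<bullet> N = 0"
  shows "pd m (pd n X) u
    = (\<Sum>q\<in>UNIV. christoffel (gram X) q m n u *\<^sub>R pd q X u) + (pd m (pd n X) u \<bullet> N) *\<^sub>R N"
proof -
  let ?G = "gram X u" and ?W = "pd m (pd n X) u"
  let ?T = "\<Sum>q\<in>UNIV. christoffel (gram X) q m n u *\<^sub>R pd q X u"
  note Xu = Ck_on_2D(1)[OF X S(2)]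
  have inv: "?G ** matrix_inv ?G = mat 1"
    using matrix_inv_mult(1)[OF invertible_gram[OF Xu inj]] .
  \<comment> \<open>Pairing with \<open>pd r X u\<close> multiplies by the Gram matrix, which
    cancels its inverse in the Christoffel symbols.\<close>
  have tang: "pd r X u \<bullet> ?T = pd r X u \<bullet> ?W" for r
  proof -
    have "pd r X u \<bullet> ?T
        = (\<Sum>q\<in>UNIV. \<Sum>l\<in>UNIV. ?G $ r $ q * matrix_inv ?G $ q $ l * (?W \<bullet> pd l X u))"
      by (simp add: inner_sum_right christoffel_gram[OF S X] sum_distrib_left sum_distrib_right
          gram_def mult_ac)
    also have "\<dots> = (\<Sum>l\<in>UNIV. (?G ** matrix_inv ?G) $ r $ l * (?W \<bullet> pd l X u))"
      by (subst sum.swap) (simp add: matrix_mult_nth sum_distrib_right)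
    also have "\<dots> = ?W \<bullet> pd r X u"
      by (simp add: inv mat_def if_distrib[of "\<lambda>x. x * _"] cong: if_cong)
    finally show ?thesis by (simp add: inner_commute)
  qed
  have NN: "N \<bullet> N = 1" using N(1) by (simp add: norm_eq_1)
  have TN: "?T \<bullet> N = 0" by (simp add: inner_sum_left N(2))
  have ax: "frechet_derivative X (at u) (axis i 1) = pd i X u" for i by (simp add: pd_def)
  have "?W - (?T + (?W \<bullet> N) *\<^sub>R N) = 0"
  proof (rule orthogonal_to_hyperplane_and_normal_imp_zero[OF codim _ inj N(1)])
    show "linear (frechet_derivative X (at u))" by (rule linear_frechet_derivative[OF Xu])
  qed (simp_all add: ax N(2) NN TN tang algebra_simps)
  then show ?thesis by simp
qed

text \<open>With the Christoffel symbols of the induced metric, the bracket is purely normal by the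
  Gauss formula. For \<open>B\<close> the inverse Gram matrix, the coefficient of \<open>N\<close>
  is minus the mean curvature.\<close>

lemma laplacian_gram:
  fixes X :: "real^'n::finite \<Rightarrow> real^'k::finite"
  assumes codim: "CARD('k) = CARD('n) + 1"
    and S: "open S" "u \<in> S" and X: "Ck_on 2 S X"
    and inj: "inj (frechet_derivative X (at u))"
    and N: "norm N = 1" "\<And>i. pd i X u \<bullet> N = 0"
  shows "(\<Sum>i\<in>UNIV. \<Sum>j\<in>UNIV. B $ i $ j *\<^sub>R
      (pd i (pd j X) u - (\<Sum>k\<in>UNIV. christoffel (gram X) k i j u *\<^sub>R pd k X u)))
    = (\<Sum>i\<in>UNIV. \<Sum>j\<in>UNIV. B $ i $ j * (pd i (pd j X) u \<bullet> N)) *\<^sub>R N"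
proof -
  have "pd i (pd j X) u - (\<Sum>k\<in>UNIV. christoffel (gram X) k i j u *\<^sub>R pd k X u)
      = (pd i (pd j X) u \<bullet> N) *\<^sub>R N" for i j
    using gauss_formula[OF assms, of i j] by (simp add: algebra_simps)
  then show ?thesis by (simp add: scaleR_sum_left)
qed

text \<open>Contracting one bilinear form with the inverse of another is independent of coordinates:
  written as a trace, the factors \<open>J\<close> cancel against those of the inverse by cyclicity.
  Used for the induced metric and the second fundamental form.\<close>

lemma sum_matrix_inv_congruence:
  fixes G B J :: "real^'n::finite^'n"
  assumes J: "invertible J" and G: "invertible G"
  shows "(\<Sum>i\<in>UNIV. \<Sum>j\<in>UNIV. matrix_inv (transpose J ** G ** J) $ i $ j * (transpose J ** B ** J) $ i $ j)
    = (\<Sum>i\<in>UNIV. \<Sum>j\<in>UNIV. matrix_inv G $ i $ j * B $ i $ j)"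
proof -
  have tr: "(\<Sum>i\<in>UNIV. \<Sum>j\<in>UNIV. A $ i $ j * C $ i $ j) = trace (A ** transpose C)"
    for A C :: "real^'n^'n"
    by (simp add: trace_def matrix_mult_nth transpose_def)
  let ?K = "matrix_inv J" and ?M = "transpose J ** G ** J"
  have JK: "J ** ?K = mat 1" "?K ** J = mat 1" using matrix_inv_mult[OF J] by auto
  have tJK: "transpose ?K ** transpose J = mat 1" "transpose J ** transpose ?K = mat 1"
    using JK by (metis matrix_transpose_mul transpose_mat)+
  \<comment> \<open>The candidate for the inverse of \<open>?M\<close>: its factors inverted, in
    reverse order.\<close>
  let ?L = "?K ** matrix_inv G ** transpose ?K"
  have "?M ** ?L = transpose J ** (G ** (J ** ?K) ** matrix_inv G) ** transpose ?K"
    by (simp add: matrix_mul_assoc)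
  then have inv: "?M ** ?L = mat 1"
    using JK tJK matrix_inv_mult[OF G] by simp
  then have "invertible ?M" by (auto simp: invertible_right_inverse)
  then have M: "matrix_inv ?M = ?L"
    using inv matrix_inv_mult(2) by (metis matrix_mul_assoc matrix_mul_lid matrix_mul_rid)
  have "trace (?L ** transpose (transpose J ** B ** J))
      = trace (?K ** (matrix_inv G ** (transpose ?K ** transpose J) ** transpose B ** J))"
    by (simp add: matrix_transpose_mul matrix_mul_assoc)
  also have "\<dots> = trace ((matrix_inv G ** transpose B ** J) ** ?K)"
    using tJK by (subst trace_mul_sym) simp
  also have "\<dots> = trace (matrix_inv G ** transpose B ** (J ** ?K))"
    by (simp add: matrix_mul_assoc)
  finally show ?thesis using JK by (simp add: tr M)
qed

section \<open>Compositions\<close>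

lemma Ck_on_2_continuous:
  assumes "Ck_on 2 S f"
  shows "continuous_on S f" "continuous_on S (pd i f)"
  using Ck_on_2D(1,2)[OF assms]
  by (meson continuous_at_imp_continuous_on differentiable_imp_continuous_within)+

text \<open>By \<open>pd_comp_second\<close> the second derivatives are sums of products of
  continuous functions.\<close>

lemma Ck_on_2_comp:
  fixes X :: "real^'n::finite \<Rightarrow> 'b::real_normed_vector" and \<Psi> :: "real^'m::finite \<Rightarrow> real^'n"
  assumes U: "open U" and \<Psi>: "Ck_on 2 U \<Psi>"
    and X: "Ck_on 2 V X" and \<Psi>V: "\<And>v. v \<in> U \<Longrightarrow> \<Psi> v \<in> V"
  shows "Ck_on 2 U (X \<circ> \<Psi>)"
proof -
  have "(X \<circ> \<Psi>) differentiable (at u)" if "u \<in> U" for u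
    using that Ck_on_2D(1)[OF \<Psi>] Ck_on_2D(1)[OF X] \<Psi>V by (blast intro: differentiable_chain_at)
  moreover have "pd i (X \<circ> \<Psi>) differentiable (at u)" if "u \<in> U" for u i
    using that pd_comp_second(1)[OF U _ \<Psi> X \<Psi>V] by blast
  moreover have "continuous_on U (pd i (pd j (X \<circ> \<Psi>)))" for i j
  proof -
    have c: "continuous_on U (\<lambda>u. g (\<Psi> u))" if "continuous_on V g" for g :: "real^'n \<Rightarrow> 'b"
      using that Ck_on_2_continuous(1)[OF \<Psi>] \<Psi>V by (intro continuous_on_compose2[of V g U \<Psi>]) auto
    have "continuous_on U (\<lambda>u. (\<Sum>q\<in>UNIV. pd i (pd j \<Psi>) u $ q *\<^sub>R pd q X (\<Psi> u))
      + (\<Sum>m\<in>UNIV. \<Sum>n\<in>UNIV. (pd i \<Psi> u $ m * pd j \<Psi> u $ n) *\<^sub>R pd m (pd n X) (\<Psi> u)))"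
      by (intro continuous_intros c Ck_on_2_continuous(2)[OF \<Psi>] Ck_on_2_continuous(2)[OF X]
          Ck_on_2D(3)[OF \<Psi>] Ck_on_2D(3)[OF X])
    then show ?thesis
      by (rule continuous_on_cong[THEN iffD1, rotated -1, OF _ refl])
        (simp add: pd_comp_second(2)[OF U _ \<Psi> X \<Psi>V])
  qed
  ultimately show ?thesis by (simp add: numeral_2_eq_2)
qed

text \<open>The chain rule for \<Phi> after \<Psi>, which is the identity near \<open>u\<close>,
  makes the derivative of \<Phi> a left inverse of that of \<Psi>.\<close>

lemma left_inverse_imp_inj_frechet_derivative:
  assumes U: "open U" "u \<in> U" and \<Psi>: "\<Psi> differentiable (at u)" and \<Phi>: "\<Phi> differentiable (at (\<Psi> u))"
    and inv: "\<And>v. v \<in> U \<Longrightarrow> \<Phi> (\<Psi> v) = v"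
  shows "inj (frechet_derivative \<Psi> (at u))"
proof -
  let ?D = "frechet_derivative \<Psi> (at u)" and ?E = "frechet_derivative \<Phi> (at (\<Psi> u))"
  have "(\<Psi> has_derivative ?D) (at u)" "(\<Phi> has_derivative ?E) (at (\<Psi> u))"
    using \<Psi> \<Phi> by (simp_all add: frechet_derivative_works)
  then have "(\<Phi> \<circ> \<Psi> has_derivative ?E \<circ> ?D) (at u)" by (rule diff_chain_at)
  then have "((\<lambda>v. v) has_derivative ?E \<circ> ?D) (at u)"
    using inv by (auto intro: has_derivative_transform_within_open[OF _ U])
  then have "?E \<circ> ?D = (\<lambda>v. v)"
    using has_derivative_unique[OF _ has_derivative_ident] by blast
  then show ?thesis by (metis comp_apply injI)
qed

lemma jacobian_nth:
  "jacobian \<Psi> (at u) $ m $ i = pd i \<Psi> u $ m"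
  by (simp add: jacobian_def matrix_def pd_def)

lemma invertible_jacobian:
  fixes \<Psi> :: "real^'n::finite \<Rightarrow> real^'n"
  assumes "\<Psi> differentiable (at u)" "inj (frechet_derivative \<Psi> (at u))"
  shows "invertible (jacobian \<Psi> (at u))"
proof -
  have "(*v) (jacobian \<Psi> (at u)) = frechet_derivative \<Psi> (at u)"
    using linear_frechet_derivative[OF assms(1)] by (auto simp: jacobian_def matrix_works)
  then have "\<exists>B. B ** jacobian \<Psi> (at u) = mat 1"
    using assms(2) by (simp add: matrix_left_invertible_injective)
  then show ?thesis by (simp add: invertible_left_inverse)
qed

lemma transpose_congruence_nth:
  fixes B J :: "real^'n::finite^'n"
  shows "(transpose J ** B ** J) $ i $ j = (\<Sum>m\<in>UNIV. \<Sum>n\<in>UNIV. J $ m $ i * J $ n $ j * B $ m $ n)"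
proof -
  have "(transpose J ** B ** J) $ i $ j = (\<Sum>n\<in>UNIV. \<Sum>m\<in>UNIV. J $ m $ i * J $ n $ j * B $ m $ n)"
    by (simp add: matrix_mult_nth transpose_def sum_distrib_right sum_distrib_left mult_ac)
  also have "\<dots> = (\<Sum>m\<in>UNIV. \<Sum>n\<in>UNIV. J $ m $ i * J $ n $ j * B $ m $ n)" by (rule sum.swap)
  finally show ?thesis .
qed

lemma gram_comp:
  fixes X :: "real^'n::finite \<Rightarrow> real^'k::finite" and \<Psi> :: "real^'n \<Rightarrow> real^'n"
  assumes \<Psi>: "\<Psi> differentiable (at u)" and X: "X differentiable (at (\<Psi> u))"
  shows "gram (X \<circ> \<Psi>) u = transpose (jacobian \<Psi> (at u)) ** gram X (\<Psi> u) ** jacobian \<Psi> (at u)"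
proof -
  have "pd i (X \<circ> \<Psi>) u \<bullet> pd j (X \<circ> \<Psi>) u
      = (\<Sum>n\<in>UNIV. \<Sum>m\<in>UNIV. pd i \<Psi> u $ m * pd j \<Psi> u $ n * (pd m X (\<Psi> u) \<bullet> pd n X (\<Psi> u)))" for i j
    by (simp add: pd_comp[OF \<Psi> X] inner_sum_left inner_sum_right sum_distrib_left mult_ac)
  then have "pd i (X \<circ> \<Psi>) u \<bullet> pd j (X \<circ> \<Psi>) u
      = (\<Sum>m\<in>UNIV. \<Sum>n\<in>UNIV. pd i \<Psi> u $ m * pd j \<Psi> u $ n * (pd m X (\<Psi> u) \<bullet> pd n X (\<Psi> u)))" for i j
    by (subst sum.swap) simp
  then show ?thesis
    by (simp add: vec_eq_iff transpose_congruence_nth gram_def jacobian_nth)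
qed

section \<open>Chain rule in time\<close>

text \<open>Time derivatives may be one-sided, so the chain rule goes through the total derivative within
  \<open>I \<times> ball\<close>.\<close>

lemma C21_on_chain_time:
  fixes F :: "real \<Rightarrow> real^'n::finite \<Rightarrow> 'b::real_normed_vector"
  assumes F: "C21_on I (I \<times> V) F" and V: "open V" and t: "t \<in> I" "\<phi> t \<in> V"
    and \<phi>: "(\<phi> has_vector_derivative w) (at t within I)"
    and F_t: "((\<lambda>s. F s (\<phi> t)) has_vector_derivative z) (at t within I)"
  shows "((\<lambda>s. F s (\<phi> s)) has_vector_derivative
    z + (\<Sum>q\<in>UNIV. w $ q *\<^sub>R pd q (F t) (\<phi> t))) (at t within I)"
proof -
  \<comment> \<open>A ball instead of \<open>V\<close>, because
    \<open>has_derivative_partialsI\<close> needs a convex set in the second variable.\<close>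
  obtain r where r: "r > 0" "ball (\<phi> t) r \<subseteq> V" using V t(2) open_contains_ball by blast
  let ?B = "ball (\<phi> t) r"
  have "continuous (at t within I) \<phi>" using \<phi> by (rule has_vector_derivative_continuous)
  then obtain e where e: "e > 0" "\<And>s. s \<in> I \<Longrightarrow> dist s t < e \<Longrightarrow> \<phi> s \<in> ?B"
    using r(1) unfolding continuous_within_eps_delta by (metis dist_commute mem_ball)
  \<comment> \<open>Shrinking \<open>I\<close> around \<open>t\<close> keeps the curve inside the
    ball and does not change derivatives at \<open>t\<close>.\<close>
  let ?I = "I \<inter> ball t e"
  have I: "at t within I = at t within ?I"
    by (rule at_within_nhd[of t "ball t e"]) (use e(1) in auto)
  \<comment> \<open>The space derivative as a bounded operator: for the total derivative it suffices
    that this operator is continuous at \<open>(t, \<phi> t)\<close> and that the time derivative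
    exists at this one point.\<close>
  define L where "L s y = Blinfun (\<lambda>v. \<Sum>i\<in>UNIV. v $ i *\<^sub>R pd i (F s) y)" for s y
  have L: "blinfun_apply (L s y) = (\<lambda>v. \<Sum>i\<in>UNIV. v $ i *\<^sub>R pd i (F s) y)" for s y
    unfolding L_def
    by (rule bounded_linear_Blinfun_apply)
      (intro bounded_linear_sum bounded_linear_scaleR_const bounded_linear_vec_nth)
  have t': "t \<in> ?I" "\<phi> t \<in> ?B" using t e(1) r(1) by auto
  have "((\<lambda>(s, y). F s y) has_derivative
      (\<lambda>(ts, ty). ts *\<^sub>R z + L t (\<phi> t) ty)) (at (t, \<phi> t) within ?I \<times> ?B)"
  proof (rule has_derivative_partialsI)
    show "((\<lambda>s. F s (\<phi> t)) has_derivative (\<lambda>ts. ts *\<^sub>R z)) (at t within ?I)"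
      using F_t I by (simp add: has_vector_derivative_def)
  next
    fix s y assume sy: "s \<in> ?I" "y \<in> ?B"
    then have "Ck_on 2 V (F s)" using F by (auto simp: C21_on_def)
    then have "F s differentiable (at y)" using sy r(2) by (auto intro: Ck_on_2D(1))
    from has_derivative_at_withinI[OF has_derivative_pd[OF this]]
    show "((\<lambda>y. F s y) has_derivative blinfun_apply (L s y)) (at y within ?B)"
      by (simp add: L)
  next
    have "continuous (at (t, \<phi> t) within ?I \<times> ?B) (\<lambda>(s, y). pd q (F s) y)" for q
    proof -
      have "continuous_on (I \<times> V) (\<lambda>(s, y). pd q (F s) y)" using F by (simp add: C21_on_def)
      then have "continuous_on (?I \<times> ?B) (\<lambda>(s, y). pd q (F s) y)"
        by (rule continuous_on_subset) (use r(2) in auto)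
      then show ?thesis using t' by (simp add: continuous_on_eq_continuous_within)
    qed
    then show "continuous (at (t, \<phi> t) within ?I \<times> ?B) (\<lambda>(s, y). L s y)"
      by (intro continuous_blinfun_componentwiseI1)
        (auto simp: L case_prod_unfold intro!: continuous_intros)
  qed (use t' in auto)
  \<comment> \<open>Restriction to the graph of \<phi> allows composition with the map from
    \<open>s\<close> to \<open>(s, \<phi> s)\<close>.\<close>
  then have total: "((\<lambda>(s, y). F s y) has_derivative (\<lambda>(ts, ty). ts *\<^sub>R z + L t (\<phi> t) ty))
      (at (t, \<phi> t) within (\<lambda>s. (s, \<phi> s)) ` ?I)"
    by (rule has_derivative_subset) (use e(2) in \<open>auto simp: dist_commute\<close>)
  have graph: "((\<lambda>s. (s, \<phi> s)) has_derivative (\<lambda>d. (d, d *\<^sub>R w))) (at t within ?I)"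
    using \<phi> I by (intro has_derivative_Pair) (auto simp: has_vector_derivative_def)
  have "((\<lambda>s. F s (\<phi> s)) has_derivative (\<lambda>d. d *\<^sub>R z + L t (\<phi> t) (d *\<^sub>R w))) (at t within ?I)"
    using has_derivative_in_compose[OF graph total] by simp
  then show ?thesis
    unfolding has_vector_derivative_def I[symmetric]
    by (simp add: L scaleR_add_right scaleR_sum_right)
qed

section \<open>Laplacians of a composition\<close>

lemma sum_rotate3:
  "(\<Sum>a\<in>A. \<Sum>b\<in>B. \<Sum>c\<in>C. f a b c) = (\<Sum>c\<in>C. \<Sum>a\<in>A. \<Sum>b\<in>B. f a b c)"
proof -
  have "(\<Sum>a\<in>A. \<Sum>b\<in>B. \<Sum>c\<in>C. f a b c) = (\<Sum>a\<in>A. \<Sum>c\<in>C. \<Sum>b\<in>B. f a b c)"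
    by (intro sum.cong refl sum.swap)
  also have "\<dots> = (\<Sum>c\<in>C. \<Sum>a\<in>A. \<Sum>b\<in>B. f a b c)" by (rule sum.swap)
  finally show ?thesis .
qed

text \<open>Invariance of the mean curvature vector under reparametrisation: the Gram matrix and the
  normal components of the second derivatives both transform by congruence with the Jacobian of
  \<Psi>, so \<open>sum_matrix_inv_congruence\<close> applies.\<close>

lemma laplacian_gram_comp:
  fixes X :: "real^'n::finite \<Rightarrow> real^'k::finite" and \<Psi> :: "real^'n \<Rightarrow> real^'n"
  assumes codim: "CARD('k) = CARD('n) + 1"
    and U: "open U" "u \<in> U" and \<Psi>: "Ck_on 2 U \<Psi>" and X: "Ck_on 2 V X"
    and \<Psi>V: "\<And>v. v \<in> U \<Longrightarrow> \<Psi> v \<in> V"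
    and inj: "inj (frechet_derivative X (at (\<Psi> u)))" "inj (frechet_derivative \<Psi> (at u))"
    and N: "norm N = 1" "\<And>q. pd q X (\<Psi> u) \<bullet> N = 0"
    and Y: "\<And>v. v \<in> U \<Longrightarrow> Y v = X (\<Psi> v)"
  shows "(\<Sum>i\<in>UNIV. \<Sum>j\<in>UNIV. matrix_inv (gram Y u) $ i $ j *\<^sub>R
      (pd i (pd j Y) u - (\<Sum>k\<in>UNIV. christoffel (gram Y) k i j u *\<^sub>R pd k Y u)))
    = (\<Sum>m\<in>UNIV. \<Sum>n\<in>UNIV. matrix_inv (gram X (\<Psi> u)) $ m $ n * (pd m (pd n X) (\<Psi> u) \<bullet> N)) *\<^sub>R N"
proof -
  note \<Psi>u = Ck_on_2D(1)[OF \<Psi> U(2)] and Xu = Ck_on_2D(1)[OF X \<Psi>V[OF U(2)]]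
  have Yeq: "(X \<circ> \<Psi>) v = Y v" if "v \<in> U" for v using Y that by simp
  have pdY: "pd i Y v = pd i (X \<circ> \<Psi>) v" if "v \<in> U" for i v
    by (rule pd_cong[OF U(1) that]) (simp add: Yeq[symmetric])
  have pd2Y: "pd i (pd j Y) u = pd i (pd j (X \<circ> \<Psi>)) u" for i j
    by (rule pd_cong[OF U]) (rule pdY)
  have CY: "Ck_on 2 U Y"
    using Ck_on_2_comp[OF U(1) \<Psi> X \<Psi>V] Ck_on_cong[OF U(1), of "X \<circ> \<Psi>" Y 2] Yeq by blast
  let ?J = "jacobian \<Psi> (at u)" and ?G = "gram X (\<Psi> u)"
    and ?B = "\<chi> m n. pd m (pd n X) (\<Psi> u) \<bullet> N"
  have pdYu: "pd i Y u = (\<Sum>q\<in>UNIV. pd i \<Psi> u $ q *\<^sub>R pd q X (\<Psi> u))" for i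
    unfolding pdY[OF U(2)] by (rule pd_comp[OF \<Psi>u Xu])
  have YN: "pd i Y u \<bullet> N = 0" for i
    by (simp add: pdYu inner_sum_left N(2))
  have "frechet_derivative (X \<circ> \<Psi>) (at u) = frechet_derivative Y (at u)"
    using Ck_on_2D(1)[OF Ck_on_2_comp[OF U(1) \<Psi> X \<Psi>V] U(2)]
    by (rule frechet_derivative_transform_within_open[OF _ U]) (auto simp: Y)
  then have injY: "inj (frechet_derivative Y (at u))"
    using inj by (metis frechet_derivative_compose[OF \<Psi>u Xu] inj_compose)
  have gY: "gram Y u = transpose ?J ** ?G ** ?J"
    using gram_comp[OF \<Psi>u Xu] by (simp add: gram_def pdY[OF U(2)])
  \<comment> \<open>The terms with second derivatives of \<Psi> are multiples of
    \<open>pd q X (\<Psi> u)\<close> and vanish against \<open>N\<close>.\<close>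
  have "pd i (pd j Y) u \<bullet> N = (transpose ?J ** ?B ** ?J) $ i $ j" for i j
    unfolding pd2Y
    by (subst pd_comp_second(2)[OF U \<Psi> X], erule \<Psi>V)
      (simp add: inner_add_left inner_sum_left N(2) transpose_congruence_nth jacobian_nth)
  then have "(\<Sum>i\<in>UNIV. \<Sum>j\<in>UNIV. matrix_inv (gram Y u) $ i $ j * (pd i (pd j Y) u \<bullet> N))
      = (\<Sum>i\<in>UNIV. \<Sum>j\<in>UNIV. matrix_inv (transpose ?J ** ?G ** ?J) $ i $ j * (transpose ?J ** ?B ** ?J) $ i $ j)"
    by (simp add: gY)
  also have "\<dots> = (\<Sum>m\<in>UNIV. \<Sum>n\<in>UNIV. matrix_inv ?G $ m $ n * ?B $ m $ n)"
    by (rule sum_matrix_inv_congruence[OF invertible_jacobian[OF \<Psi>u inj(2)] invertible_gram[OF Xu inj(1)]])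
  finally show ?thesis
    unfolding laplacian_gram[OF codim U CY injY N(1) YN] by simp
qed

text \<open>The tangential part of the Laplacian of a composition is the push-forward of the map
  Laplacian, since by the Gauss formula the second derivatives of \<open>X\<close> are tangentially the
  Christoffel symbols of its induced metric.\<close>

lemma laplacian_comp_tangential:
  fixes X :: "real^'n::finite \<Rightarrow> real^'k::finite" and \<Psi> :: "real^'n \<Rightarrow> real^'n"
  assumes codim: "CARD('k) = CARD('n) + 1"
    and U: "open U" "u \<in> U" and \<Psi>: "Ck_on 2 U \<Psi>" and V: "open V" and X: "Ck_on 2 V X"
    and \<Psi>V: "\<And>v. v \<in> U \<Longrightarrow> \<Psi> v \<in> V"
    and inj: "inj (frechet_derivative X (at (\<Psi> u)))"
    and N: "norm N = 1" "\<And>q. pd q X (\<Psi> u) \<bullet> N = 0"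
    and Y: "\<And>v. v \<in> U \<Longrightarrow> Y v = X (\<Psi> v)"
  shows "\<exists>c. (\<Sum>i\<in>UNIV. \<Sum>j\<in>UNIV. B $ i $ j *\<^sub>R
      (pd i (pd j Y) u - (\<Sum>k\<in>UNIV. \<Gamma> k i j *\<^sub>R pd k Y u)))
    = (\<Sum>q\<in>UNIV. (\<Sum>i\<in>UNIV. \<Sum>j\<in>UNIV. B $ i $ j *
        (pd i (pd j (\<lambda>v. \<Psi> v $ q)) u - (\<Sum>k\<in>UNIV. \<Gamma> k i j * pd k (\<lambda>v. \<Psi> v $ q) u)
         + (\<Sum>m\<in>UNIV. \<Sum>n\<in>UNIV. christoffel (gram X) q m n (\<Psi> u)
              * pd i (\<lambda>v. \<Psi> v $ m) u * pd j (\<lambda>v. \<Psi> v $ n) u))) *\<^sub>R pd q X (\<Psi> u)) + c *\<^sub>R N"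
proof -
  note \<Psi>u = Ck_on_2D(1)[OF \<Psi> U(2)] and Xu = Ck_on_2D(1)[OF X \<Psi>V[OF U(2)]]
  have pdY: "pd i Y v = pd i (X \<circ> \<Psi>) v" if "v \<in> U" for i v
    by (rule pd_cong[OF U(1) that]) (simp add: Y)
  have pd2Y: "pd i (pd j Y) u = pd i (pd j (X \<circ> \<Psi>)) u" for i j
    by (rule pd_cong[OF U]) (rule pdY)
  have pdYu: "pd i Y u = (\<Sum>q\<in>UNIV. pd i \<Psi> u $ q *\<^sub>R pd q X (\<Psi> u))" for i
    unfolding pdY[OF U(2)] by (rule pd_comp[OF \<Psi>u Xu])
  have comp1: "pd i (\<lambda>v. \<Psi> v $ q) v = pd i \<Psi> v $ q" if "v \<in> U" for i q v
    using pd_vec_nth Ck_on_2D(1)[OF \<Psi> that] by blast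
  have comp2: "pd i (pd j (\<lambda>v. \<Psi> v $ q)) u = pd i (pd j \<Psi>) u $ q" for i j q
  proof -
    have "pd i (pd j (\<lambda>v. \<Psi> v $ q)) u = pd i (\<lambda>v. pd j \<Psi> v $ q) u"
      by (rule pd_cong[OF U]) (rule comp1)
    then show ?thesis by (simp add: pd_vec_nth[OF Ck_on_2D(2)[OF \<Psi> U(2)]])
  qed
  let ?II = "\<lambda>m n. pd m (pd n X) (\<Psi> u) \<bullet> N"
  \<comment> \<open>The second fundamental form of \<open>X\<close> pulled back by \<Psi>.
    Contracted with \<open>B\<close> it gives \<open>c\<close>, left unspecified because the
    tangential projection removes it later.\<close>
  define d where "d i j = (\<Sum>m\<in>UNIV. \<Sum>n\<in>UNIV. pd i \<Psi> u $ m * pd j \<Psi> u $ n * ?II m n)" for i j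
  let ?E = "\<lambda>q i j. pd i (pd j \<Psi>) u $ q - (\<Sum>k\<in>UNIV. \<Gamma> k i j * pd k \<Psi> u $ q)
    + (\<Sum>m\<in>UNIV. \<Sum>n\<in>UNIV. christoffel (gram X) q m n (\<Psi> u) * pd i \<Psi> u $ m * pd j \<Psi> u $ n)"
  \<comment> \<open>Before contraction with \<open>B\<close>: the Gauss formula splits the second
    derivatives of \<open>X\<close> in the chain rule, and \<open>?E q i j\<close> collects the
    coefficients of \<open>pd q X (\<Psi> u)\<close>.\<close>
  have "pd i (pd j Y) u - (\<Sum>k\<in>UNIV. \<Gamma> k i j *\<^sub>R pd k Y u)
      = (\<Sum>q\<in>UNIV. ?E q i j *\<^sub>R pd q X (\<Psi> u)) + d i j *\<^sub>R N" for i j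
  proof -
    have "(\<Sum>m\<in>UNIV. \<Sum>n\<in>UNIV. (pd i \<Psi> u $ m * pd j \<Psi> u $ n) *\<^sub>R pd m (pd n X) (\<Psi> u))
      = (\<Sum>m\<in>UNIV. \<Sum>n\<in>UNIV. \<Sum>q\<in>UNIV. (christoffel (gram X) q m n (\<Psi> u) * pd i \<Psi> u $ m * pd j \<Psi> u $ n) *\<^sub>R pd q X (\<Psi> u))
        + d i j *\<^sub>R N"
      by (subst gauss_formula[OF codim V \<Psi>V[OF U(2)] X inj N])
        (simp add: d_def scaleR_add_right sum.distrib scaleR_sum_right scaleR_sum_left mult_ac)
    also have "(\<Sum>m\<in>UNIV. \<Sum>n\<in>UNIV. \<Sum>q\<in>UNIV. (christoffel (gram X) q m n (\<Psi> u) * pd i \<Psi> u $ m * pd j \<Psi> u $ n) *\<^sub>R pd q X (\<Psi> u))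
      = (\<Sum>q\<in>UNIV. (\<Sum>m\<in>UNIV. \<Sum>n\<in>UNIV. christoffel (gram X) q m n (\<Psi> u) * pd i \<Psi> u $ m * pd j \<Psi> u $ n) *\<^sub>R pd q X (\<Psi> u))"
      unfolding scaleR_sum_left by (rule sum_rotate3)
    finally have second: "(\<Sum>m\<in>UNIV. \<Sum>n\<in>UNIV. (pd i \<Psi> u $ m * pd j \<Psi> u $ n) *\<^sub>R pd m (pd n X) (\<Psi> u))
      = \<dots> + d i j *\<^sub>R N" .
    have "(\<Sum>k\<in>UNIV. \<Gamma> k i j *\<^sub>R pd k Y u)
        = (\<Sum>q\<in>UNIV. (\<Sum>k\<in>UNIV. \<Gamma> k i j * pd k \<Psi> u $ q) *\<^sub>R pd q X (\<Psi> u))"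
      unfolding pdYu scaleR_sum_right scaleR_sum_left scaleR_scaleR by (rule sum.swap)
    moreover have "pd i (pd j (X \<circ> \<Psi>)) u = (\<Sum>q\<in>UNIV. pd i (pd j \<Psi>) u $ q *\<^sub>R pd q X (\<Psi> u))
      + (\<Sum>m\<in>UNIV. \<Sum>n\<in>UNIV. (pd i \<Psi> u $ m * pd j \<Psi> u $ n) *\<^sub>R pd m (pd n X) (\<Psi> u))"
      by (rule pd_comp_second(2)[OF U \<Psi> X]) (rule \<Psi>V)
    ultimately show ?thesis
      unfolding pd2Y second
      by (simp add: scaleR_add_left scaleR_diff_left sum.distrib sum_subtractf)
  qed
  then have "(\<Sum>i\<in>UNIV. \<Sum>j\<in>UNIV. B $ i $ j *\<^sub>R
      (pd i (pd j Y) u - (\<Sum>k\<in>UNIV. \<Gamma> k i j *\<^sub>R pd k Y u)))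
      = (\<Sum>i\<in>UNIV. \<Sum>j\<in>UNIV. \<Sum>q\<in>UNIV. (B $ i $ j * ?E q i j) *\<^sub>R pd q X (\<Psi> u))
        + (\<Sum>i\<in>UNIV. \<Sum>j\<in>UNIV. B $ i $ j * d i j) *\<^sub>R N"
    by (simp only: scaleR_add_right sum.distrib scaleR_sum_right scaleR_scaleR scaleR_sum_left)
  also have "(\<Sum>i\<in>UNIV. \<Sum>j\<in>UNIV. \<Sum>q\<in>UNIV. (B $ i $ j * ?E q i j) *\<^sub>R pd q X (\<Psi> u))
      = (\<Sum>q\<in>UNIV. (\<Sum>i\<in>UNIV. \<Sum>j\<in>UNIV. B $ i $ j * ?E q i j) *\<^sub>R pd q X (\<Psi> u))"
    unfolding scaleR_sum_left by (rule sum_rotate3)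
  finally show ?thesis
    unfolding comp2 comp1[OF U(2)] by blast
qed

section \<open>Charts and the flow\<close>

lemma outer_mult_vector: "outer a b *v c = (b \<bullet> c) *\<^sub>R a"
  by (simp add: vec_eq_iff outer_def matrix_vector_mult_def inner_vec_def sum_distrib_left mult_ac)

lemma is_chart_cinv:
  assumes "is_chart C"
  shows "u \<in> cimg C \<Longrightarrow> cinv C u \<in> cdom C" "u \<in> cimg C \<Longrightarrow> cmap C (cinv C u) = u"
    "p \<in> cdom C \<Longrightarrow> cinv C (cmap C p) = p" "continuous_on (cimg C) (cinv C)"
    "open (cdom C)" "open (cimg C)"
  using assms by (auto simp: is_chart_def homeomorphism_def)

lemma cmap_in_cimg: "p \<in> cdom C \<Longrightarrow> cmap C p \<in> cimg C"
  by (simp add: cimg_def)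

lemma open_chart_preimage:
  assumes "is_chart C1" "is_chart C2" "continuous_on UNIV f"
  shows "open {u \<in> cimg C1. f (cinv C1 u) \<in> cdom C2}"
proof -
  have "continuous_on (cimg C1) (\<lambda>u. f (cinv C1 u))"
    using assms(3) is_chart_cinv(4)[OF assms(1)] by (rule continuous_on_compose2) simp
  then have "open (cimg C1 \<inter> (\<lambda>u. f (cinv C1 u)) -` cdom C2)"
    using is_chart_cinv(6)[OF assms(1)] is_chart_cinv(5)[OF assms(2)]
    by (rule continuous_open_preimage)
  then show ?thesis by (simp add: vimage_def Int_def)
qed

text \<open>The chart representation of \<open>inv f\<close> is a differentiable left inverse of
  that of \<open>f\<close> near \<open>u\<close>.\<close>

lemma Ck_diffeo_inj_frechet_derivative:
  assumes f: "Ck_diffeo 2 A f" and C: "C1 \<in> A" "C2 \<in> A" "is_chart C1" "is_chart C2"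
    and u: "u \<in> cimg C1" "f (cinv C1 u) \<in> cdom C2"
  shows "inj (frechet_derivative (cmap C2 \<circ> f \<circ> cinv C1) (at u))"
proof -
  let ?U = "{v \<in> cimg C1. f (cinv C1 v) \<in> cdom C2}" and ?F = "cmap C2 \<circ> f \<circ> cinv C1"
    and ?E = "cmap C1 \<circ> inv f \<circ> cinv C2"
  have inv: "inv f (f q) = q" for q
    using f by (simp add: Ck_diffeo_def bij_is_inj)
  have return: "cinv C2 (?F v) = f (cinv C1 v)" if "v \<in> ?U" for v
    using that is_chart_cinv(3)[OF C(4)] by simp
  \<comment> \<open>The image of \<open>u\<close> has to lie in the set on which
    \<open>Ck_map\<close> gives regularity of \<open>?E\<close>.\<close>
  have "?F u \<in> {w \<in> cimg C2. inv f (cinv C2 w) \<in> cdom C1}"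
    using u return[of u] is_chart_cinv(1)[OF C(3) u(1)] by (simp add: inv cmap_in_cimg)
  then have "?E differentiable (at (?F u))"
    using f C Ck_on_2D(1) unfolding Ck_diffeo_def Ck_map_def by blast
  moreover have "?F differentiable (at u)"
    using f C u Ck_on_2D(1) unfolding Ck_diffeo_def Ck_map_def by blast
  moreover have "open ?U"
    using f open_chart_preimage[OF C(3,4)] unfolding Ck_diffeo_def Ck_map_def by blast
  moreover have "?E (?F v) = v" if "v \<in> ?U" for v
  proof -
    have "?E (?F v) = cmap C1 (inv f (cinv C2 (?F v)))" by simp
    also have "\<dots> = v" using that is_chart_cinv(2)[OF C(3)] by (simp only: return inv) simp
    finally show ?thesis .
  qed
  ultimately show ?thesis
    using u by (intro left_inverse_imp_inj_frechet_derivative[of ?U u ?F ?E]) auto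
qed

section \<open>The evolution equation of the reparametrised flow\<close>

theorem theorem4:
  fixes A :: "('m::{t2_space, second_countable_topology}, 'n::finite) chart set"
    and h :: "('m, 'n) metric"
    and \<alpha> T :: real
    and x xhat :: "real \<Rightarrow> 'm \<Rightarrow> real^'k::finite"
    and x0 :: "'m \<Rightarrow> real^'k"
    and \<psi> :: "real \<Rightarrow> 'm \<Rightarrow> 'm"
    and \<nu> :: "real \<Rightarrow> real^'k \<Rightarrow> real^'k"
  assumes codim: "CARD('k) = CARD('n) + 1"
    and mfd: "closed_connected_orientable_manifold A"
    and h: "smooth_riemannian_metric A h"
    and alpha: "\<alpha> > 0"
    and T: "T > 0"
    and x_reg: "C21_family_into_space A {0..<T} x"
    and x_emb: "\<forall>t\<in>{0..<T}. embedding A (x t)"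
    and normal: "\<forall>t\<in>{0..<T}. unit_normal_field A (x t) (\<nu> t)"
    and mcf: "\<forall>t\<in>{0..<T}. \<forall>p. \<forall>C\<in>A. p \<in> cdom C \<longrightarrow>
      ((\<lambda>s. x s p) has_vector_derivative - (mean_curvature C (x t) (\<nu> t) p *\<^sub>R \<nu> t (x t p)))
        (at t within {0..<T})"
    and x_init: "\<forall>p. x 0 p = x0 p"
    and psi_reg: "C21_family_of_self_maps A {0..<T} \<psi>"
    and psi_diffeo: "\<forall>t\<in>{0..<T}. Ck_diffeo 2 A (\<psi> t)"
    and psi_flow: "\<forall>t\<in>{0..<T}. \<forall>p. \<forall>C1\<in>A. \<forall>C2\<in>A. p \<in> cdom C1 \<longrightarrow> \<psi> t p \<in> cdom C2 \<longrightarrow>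
      ((\<lambda>s. cmap C2 (\<psi> s p)) has_vector_derivative
         (1 / \<alpha>) *\<^sub>R map_laplacian C1 C2 h (pullback_metric (x t)) (\<psi> t) p) (at t within {0..<T})"
    and psi_init: "\<forall>p. \<psi> 0 p = p"
    and xhat: "\<forall>t\<in>{0..<T}. xhat t = x t \<circ> \<psi> t"
  shows "(\<forall>t\<in>{0..<T}. \<forall>p. \<forall>C\<in>A. p \<in> cdom C \<longrightarrow>
            (let ghat = pullback_metric (xhat t);
                 \<rho> = volume_ratio C h ghat p;
                 N = outer (\<nu> t (xhat t p)) (\<nu> t (xhat t p));
                 P = mat 1 - N
             in (\<lambda>s. xhat s p) differentiable (at t within {0..<T}) \<and>
                ((\<alpha> * \<rho>) *\<^sub>R mat 1 + (1 - \<alpha> * \<rho>) *\<^sub>R N) *v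
                    vector_derivative (\<lambda>s. xhat s p) (at t within {0..<T})
                  = laplacian C ghat (xhat t) p + \<rho> *\<^sub>R (P *v laplacian C h (xhat t) p)))
       \<and> (\<forall>p. xhat 0 p = x0 p)"
proof (intro conjI ballI allI impI)
  fix p
  show "xhat 0 p = x0 p"
    using xhat T psi_init x_init by simp
next
  fix t p C
  assume t: "t \<in> {0..<T}" and C: "C \<in> A" and p: "p \<in> cdom C"
  have atlas: "smooth_atlas A" using mfd by (simp add: closed_connected_orientable_manifold_def)
  \<comment> \<open>Two charts are in play: the given \<open>C\<close> at \<open>p\<close> and some
    \<open>C2\<close> at the moved point \<open>\<psi> t p\<close>.\<close>
  then obtain C2 where C2: "C2 \<in> A" "\<psi> t p \<in> cdom C2"
    unfolding smooth_atlas_def by blast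
  have chart: "is_chart C" "is_chart C2"
    using atlas C C2 by (auto simp: smooth_atlas_def)
  define X where "X = x t \<circ> cinv C2"
  define \<Psi> where "\<Psi> = cmap C2 \<circ> \<psi> t \<circ> cinv C"
  define Y where "Y = xhat t \<circ> cinv C"
  \<comment> \<open>The coordinate domain on which \<open>Y\<close> factors as
    \<open>X \<circ> \<Psi>\<close>.\<close>
  define U where "U = {u \<in> cimg C. \<psi> t (cinv C u) \<in> cdom C2}"
  define u where "u = cmap C p"
  define n where "n = \<nu> t (xhat t p)"
  have diffeo: "Ck_diffeo 2 A (\<psi> t)" using psi_diffeo t by blast
  have u: "u \<in> cimg C" "cinv C u = p"
    using is_chart_cinv(3)[OF chart(1) p] by (simp_all add: u_def cmap_in_cimg p)
  have U: "open U" "u \<in> U"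
    using diffeo open_chart_preimage[OF chart] u C2
    by (auto simp: U_def Ck_diffeo_def Ck_map_def)
  have \<Psi>: "Ck_on 2 U \<Psi>"
    using diffeo C C2 by (auto simp: U_def \<Psi>_def Ck_diffeo_def Ck_map_def)
  have \<Psi>V: "\<Psi> v \<in> cimg C2" if "v \<in> U" for v
    using that by (simp add: U_def \<Psi>_def cmap_in_cimg)
  have \<Psi>u: "\<Psi> u = cmap C2 (\<psi> t p)" "cinv C2 (\<Psi> u) = \<psi> t p"
    using is_chart_cinv(3)[OF chart(2) C2(2)] by (simp_all add: \<Psi>_def u)
  have V: "open (cimg C2)" using is_chart_cinv(6)[OF chart(2)] .
  have reg: "C21_on {0..<T} ({0..<T} \<times> cimg C2) (\<lambda>s. x s \<circ> cinv C2)"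
    using x_reg C2 by (simp add: C21_family_into_space_def)
  have X: "Ck_on 2 (cimg C2) X"
    using reg t by (auto simp: C21_on_def X_def)
  have injX: "inj (frechet_derivative X (at (\<Psi> u)))"
    using x_emb t C2 \<Psi>V[OF U(2)] by (auto simp: embedding_def X_def)
  have inj\<Psi>: "inj (frechet_derivative \<Psi> (at u))"
    unfolding \<Psi>_def using C2 u
    by (intro Ck_diffeo_inj_frechet_derivative[OF diffeo C C2(1) chart]) simp_all
  have xh: "xhat t p = x t (\<psi> t p)" "X (\<Psi> u) = x t (\<psi> t p)"
    using xhat t by (simp_all add: X_def \<Psi>u(2))
  have N: "norm n = 1" "pd q X (\<Psi> u) \<bullet> n = 0" for q
    using normal t C2 \<Psi>V[OF U(2)] by (auto simp: unit_normal_field_def n_def X_def xh \<Psi>u(2)[symmetric])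
  have Y: "Y v = X (\<Psi> v)" if "v \<in> U" for v
    using that xhat t is_chart_cinv(3)[OF chart(2)] by (simp add: Y_def X_def \<Psi>_def U_def)
  have pull: "pullback_metric (x t) C2 = gram X" "pullback_metric (xhat t) C = gram Y"
    by (auto simp: pullback_metric_def gram_def X_def Y_def)

  \<comment> \<open>\<open>H\<close> is the curvature of the original \<open>x t\<close> at
    \<open>\<psi> t p\<close>; \<tau> pushes the map Laplacian \<open>m\<close> forward by the
    derivative of \<open>X\<close>.\<close>
  define H where "H = mean_curvature C2 (x t) (\<nu> t) (\<psi> t p)"
  define m where "m = map_laplacian C C2 h (pullback_metric (x t)) (\<psi> t) p"
  define \<tau> where "\<tau> = (\<Sum>q\<in>UNIV. m $ q *\<^sub>R pd q X (\<Psi> u))"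
  have lap_hat: "laplacian C (pullback_metric (xhat t)) (xhat t) p = - H *\<^sub>R n"
    using laplacian_gram_comp[OF codim U \<Psi> X \<Psi>V injX inj\<Psi> N Y]
    unfolding laplacian_def Let_def pull H_def mean_curvature_def X_def[symmetric] Y_def[symmetric]
      u_def[symmetric] \<Psi>u(1)[symmetric] xh(2) n_def xh(1)
    by (simp only: minus_minus)
  obtain c where lap_h: "laplacian C h (xhat t) p = \<tau> + c *\<^sub>R n"
    using laplacian_comp_tangential[OF codim U \<Psi> V X \<Psi>V injX N Y,
        of "matrix_inv (h C u)" "\<lambda>k i j. christoffel (h C) k i j u"]
    by (auto simp: laplacian_def Let_def map_laplacian_def m_def \<tau>_def pull \<Psi>_def[symmetric]
        Y_def[symmetric] u_def[symmetric])

  have \<phi>: "((\<lambda>s. cmap C2 (\<psi> s p)) has_vector_derivative (1 / \<alpha>) *\<^sub>R m) (at t within {0..<T})"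
    using psi_flow t C C2 p by (simp add: m_def)
  have xdot: "((\<lambda>s. (x s \<circ> cinv C2) (cmap C2 (\<psi> t p))) has_vector_derivative - (H *\<^sub>R n)) (at t within {0..<T})"
    using mcf t C2 by (simp add: H_def n_def xh(1) \<Psi>u(2)[unfolded \<Psi>u(1)])
  have "((\<lambda>s. (x s \<circ> cinv C2) (cmap C2 (\<psi> s p))) has_vector_derivative
      - (H *\<^sub>R n) + (\<Sum>q\<in>UNIV. ((1 / \<alpha>) *\<^sub>R m) $ q *\<^sub>R pd q (x t \<circ> cinv C2) (cmap C2 (\<psi> t p))))
      (at t within {0..<T})"
    by (rule C21_on_chain_time[OF reg V t _ \<phi> xdot]) (simp add: cmap_in_cimg C2)
  also have "- (H *\<^sub>R n) + (\<Sum>q\<in>UNIV. ((1 / \<alpha>) *\<^sub>R m) $ q *\<^sub>R pd q (x t \<circ> cinv C2) (cmap C2 (\<psi> t p)))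
      = - (H *\<^sub>R n) + (1 / \<alpha>) *\<^sub>R \<tau>"
    by (simp add: \<tau>_def X_def \<Psi>u(1) scaleR_sum_right)
  finally have deriv_local: "((\<lambda>s. (x s \<circ> cinv C2) (cmap C2 (\<psi> s p))) has_vector_derivative
      - (H *\<^sub>R n) + (1 / \<alpha>) *\<^sub>R \<tau>) (at t within {0..<T})" .
  \<comment> \<open>The representation in \<open>C2\<close> equals \<open>xhat s p\<close> as long
    as \<open>\<psi> s p\<close> lies in the domain of \<open>C2\<close>; continuity in time ensures
    this near \<open>t\<close>.\<close>
  have "continuous_on {0..<T} (\<lambda>s. \<psi> s p)"
  proof -
    have "continuous_on ({0..<T} \<times> UNIV) (\<lambda>(s, q). \<psi> s q)"
      using psi_reg by (simp add: C21_family_of_self_maps_def)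
    moreover have "continuous_on {0..<T} (\<lambda>s. (s, p))" by (intro continuous_intros)
    ultimately have "continuous_on {0..<T} (\<lambda>s. case (s, p) of (s, q) \<Rightarrow> \<psi> s q)"
      by (rule continuous_on_compose2) auto
    then show ?thesis by simp
  qed
  then have "\<forall>\<^sub>F s in at t within {0..<T}. \<psi> s p \<in> cdom C2"
    using t C2(2) is_chart_cinv(5)[OF chart(2)]
    by (auto simp: continuous_on_def dest: topological_tendstoD)
  then obtain d where d: "d > 0" "\<And>s. s \<in> {0..<T} \<Longrightarrow> dist s t < d \<Longrightarrow> \<psi> s p \<in> cdom C2"
    using C2(2) unfolding eventually_at by (metis)
  have deriv: "((\<lambda>s. xhat s p) has_vector_derivative - (H *\<^sub>R n) + (1 / \<alpha>) *\<^sub>R \<tau>) (at t within {0..<T})"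
  proof (rule has_vector_derivative_transform_within[OF deriv_local d(1) t])
    fix s assume "s \<in> {0..<T}" "dist s t < d"
    then show "(x s \<circ> cinv C2) (cmap C2 (\<psi> s p)) = xhat s p"
      using d(2) xhat is_chart_cinv(3)[OF chart(2)] by simp
  qed
  \<comment> \<open>Uniqueness of the derivative within the interval requires \<open>t\<close> to be
    a limit point of it; by \<open>T > 0\<close> this includes \<open>t = 0\<close>.\<close>
  have "at t within {0..<T} \<noteq> bot"
    using t T trivial_limit_within[of t "{0..<T}"] by (simp add: trivial_limit_def)
  from vector_derivative_within[OF this deriv]
  have vd: "vector_derivative (\<lambda>s. xhat s p) (at t within {0..<T}) = - (H *\<^sub>R n) + (1 / \<alpha>) *\<^sub>R \<tau>" .
  have n\<tau>: "n \<bullet> \<tau> = 0" by (simp add: \<tau>_def inner_sum_right N(2) inner_commute[of n])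
  have nn: "n \<bullet> n = 1" using N(1) by (simp add: norm_eq_1)
  define \<rho> where "\<rho> = volume_ratio C h (pullback_metric (xhat t)) p"
  \<comment> \<open>The matrix on the left fixes \<open>n\<close> and multiplies the tangential
    \<tau> by \<open>\<alpha> * \<rho>\<close>, which cancels the factor
    \<open>1 / \<alpha>\<close>; the projection on the right keeps \<tau> and kills
    \<open>c *\<^sub>R n\<close>.\<close>
  have "((\<alpha> * \<rho>) *\<^sub>R mat 1 + (1 - \<alpha> * \<rho>) *\<^sub>R outer n n) *v (- (H *\<^sub>R n) + (1 / \<alpha>) *\<^sub>R \<tau>)
      = - H *\<^sub>R n + \<rho> *\<^sub>R ((mat 1 - outer n n) *v (\<tau> + c *\<^sub>R n))"
    using alpha
    by (simp add: matrix_vector_mult_add_rdistrib matrix_vector_mult_diff_rdistrib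
        scaleR_matrix_vector_assoc[symmetric] outer_mult_vector inner_add_right inner_diff_right n\<tau> nn algebra_simps)
  moreover have "(\<lambda>s. xhat s p) differentiable (at t within {0..<T})"
    using deriv by (rule differentiableI_vector)
  ultimately show "let ghat = pullback_metric (xhat t);
                 \<rho> = volume_ratio C h ghat p;
                 N = outer (\<nu> t (xhat t p)) (\<nu> t (xhat t p));
                 P = mat 1 - N
             in (\<lambda>s. xhat s p) differentiable (at t within {0..<T}) \<and>
                ((\<alpha> * \<rho>) *\<^sub>R mat 1 + (1 - \<alpha> * \<rho>) *\<^sub>R N) *v
                    vector_derivative (\<lambda>s. xhat s p) (at t within {0..<T})
                  = laplacian C ghat (xhat t) p + \<rho> *\<^sub>R (P *v laplacian C h (xhat t) p)"
    unfolding Let_def vd lap_hat lap_h n_def[symmetric] \<rho>_def[symmetric] by blast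
qed

end
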